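(* Let $(X,\mu)$ be a standard non-atomic probability space. Let $G$ be a non-abelian finitely generated free group and $a\in A(G,X,\mu)$ be essentially free. Let $S\subset G$ be a free generating set. Suppose that for every $s\in S$, the automorphism $a(s)\in\mathrm{Aut}(X,\mu)$ is ergodic. Let $[a]_{OE}$ be the set of all actions $b\in A(G,X,\mu)$ which are orbit-equivalent to $a$. Then $[a]_{OE}$ is dense in $A(G,X,\mu)$.
   Context: $\mathrm{Aut}(X,\mu)$ is the group of all measure-preserving automorphisms of $(X,\mu)$, two automorphisms being identified if they agree on a conull set. The weak topology on $\mathrm{Aut}(X,\mu)$ is the one induced by the metric $d_w(T,S)=\sum_{i\ge 1}2^{-i}\mu(TA_i \vartriangle SA_i)$, where $\{A_i\}_{i\ge 1}$ is any sequence of measurable sets dense in the measure algebra of $\mu$ for the distance $d(A,B)=\mu(A\vartriangle B)$ (the topology does not depend on the sequence). For a countable group $G$, an action of $G$ is a homomorphism $a:G\to \mathrm{Aut}(X,\mu)$, and $A(G,X,\mu)$ is the set of all such actions, with the subspace topology from $\mathrm{Aut}(X,\mu)^G$, which carries the product of the weak topologies. An action $a$ is essentially free if for a.e. $x\in X$, $\{g\in G: a(g)x=x\}=\{e_G\}$. Two actions $a,b\in A(G,X,\mu)$ are orbit-equivalent if there is $T\in \mathrm{Aut}(X,\mu)$ with $T(a(G)x)=b(G)T(x)$ for a.e. $x\in X$. *)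

theory Defs
  imports "HOL-Probability.Probability" "HOL-Algebra.Generated_Groups"
begin

section \<open>Standard non-atomic probability spaces\<close>

definition standard_borel_space :: "'x measure \<Rightarrow> bool" where
  "standard_borel_space M \<longleftrightarrow>
     (\<exists>X. topspace X = space M \<and> completely_metrizable_space X \<and> second_countable X \<and>
          sets M = sigma_sets (space M) {U. openin X U})"

definition non_atomic :: "'x measure \<Rightarrow> bool" where
  "non_atomic M \<longleftrightarrow>
     (\<forall>A\<in>sets M. 0 < measure M A \<longrightarrow>
        (\<exists>B\<in>sets M. B \<subseteq> A \<and> 0 < measure M B \<and> measure M B < measure M A))"

section \<open>The automorphism group\<close>

definition mp_automorphisms :: "'x measure \<Rightarrow> ('x \<Rightarrow> 'x) set" where
  "mp_automorphisms M =
     {T. bij_betw T (space M) (space M) \<and> T \<in> measurable M M \<and>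
         inv_into (space M) T \<in> measurable M M \<and> distr M M T = M}"

definition ae_equal :: "'x measure \<Rightarrow> (('x \<Rightarrow> 'x) \<times> ('x \<Rightarrow> 'x)) set" where
  "ae_equal M =
     {(S, T). S \<in> mp_automorphisms M \<and> T \<in> mp_automorphisms M \<and> (AE x in M. S x = T x)}"

text \<open>Elements of \<open>Aut M\<close> are equivalence classes modulo almost everywhere equality, multiplied
  by composing representatives.\<close>

definition Aut :: "'x measure \<Rightarrow> ('x \<Rightarrow> 'x) set monoid" where
  "Aut M =
     \<lparr> carrier = mp_automorphisms M // ae_equal M,
       mult = (\<lambda>C D. \<Union>S\<in>C. \<Union>T\<in>D. ae_equal M `` {S \<circ> T}),
       one = ae_equal M `` {id} \<rparr>"

text \<open>All notions below depend on the chosen representative only up to a null set.\<close>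

definition rep :: "('x \<Rightarrow> 'x) set \<Rightarrow> 'x \<Rightarrow> 'x" where
  "rep C = (SOME T. T \<in> C)"

section \<open>The weak topology\<close>

definition dense_sequence :: "'x measure \<Rightarrow> (nat \<Rightarrow> 'x set) \<Rightarrow> bool" where
  "dense_sequence M A \<longleftrightarrow>
     range A \<subseteq> sets M \<and>
     (\<forall>B\<in>sets M. \<forall>\<epsilon>>0. \<exists>i. measure M (sym_diff (A i) B) < \<epsilon>)"

text \<open>The sequence is indexed from \<open>0\<close> instead of \<open>1\<close>, hence the exponent \<open>Suc i\<close>.\<close>

definition weak_dist ::
    "'x measure \<Rightarrow> (nat \<Rightarrow> 'x set) \<Rightarrow> ('x \<Rightarrow> 'x) set \<Rightarrow> ('x \<Rightarrow> 'x) set \<Rightarrow> real" where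
  "weak_dist M A C D =
     (\<Sum>i. (1/2) ^ Suc i * measure M (sym_diff (rep C ` A i) (rep D ` A i)))"

definition weak_topology :: "'x measure \<Rightarrow> (nat \<Rightarrow> 'x set) \<Rightarrow> ('x \<Rightarrow> 'x) set topology" where
  "weak_topology M A = Metric_space.mtopology (carrier (Aut M)) (weak_dist M A)"

section \<open>Actions\<close>

text \<open>Actions are taken to be extensional outside \<open>carrier G\<close>, as are the points of the product
  topology indexed by \<open>carrier G\<close>.\<close>

definition actions ::
    "('g, 'b) monoid_scheme \<Rightarrow> 'x measure \<Rightarrow> ('g \<Rightarrow> ('x \<Rightarrow> 'x) set) set" where
  "actions G M = hom G (Aut M) \<inter> extensional (carrier G)"

definition action_topology ::
    "('g, 'b) monoid_scheme \<Rightarrow> 'x measure \<Rightarrow> (nat \<Rightarrow> 'x set) \<Rightarrow>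
       ('g \<Rightarrow> ('x \<Rightarrow> 'x) set) topology" where
  "action_topology G M A =
     subtopology (product_topology (\<lambda>_. weak_topology M A) (carrier G)) (actions G M)"

definition essentially_free ::
    "('g, 'b) monoid_scheme \<Rightarrow> 'x measure \<Rightarrow> ('g \<Rightarrow> ('x \<Rightarrow> 'x) set) \<Rightarrow> bool" where
  "essentially_free G M a \<longleftrightarrow>
     (AE x in M. {g \<in> carrier G. rep (a g) x = x} = {\<one>\<^bsub>G\<^esub>})"

definition ergodic :: "'x measure \<Rightarrow> ('x \<Rightarrow> 'x) set \<Rightarrow> bool" where
  "ergodic M C \<longleftrightarrow>
     (\<forall>B\<in>sets M. measure M (sym_diff (rep C ` B) B) = 0 \<longrightarrow> measure M B = 0 \<or> measure M B = 1)"

definition orbit ::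
    "('g, 'b) monoid_scheme \<Rightarrow> ('g \<Rightarrow> ('x \<Rightarrow> 'x) set) \<Rightarrow> 'x \<Rightarrow> 'x set" where
  "orbit G a x = (\<lambda>g. rep (a g) x) ` carrier G"

definition orbit_equivalent ::
    "('g, 'b) monoid_scheme \<Rightarrow> 'x measure \<Rightarrow>
       ('g \<Rightarrow> ('x \<Rightarrow> 'x) set) \<Rightarrow> ('g \<Rightarrow> ('x \<Rightarrow> 'x) set) \<Rightarrow> bool" where
  "orbit_equivalent G M a b \<longleftrightarrow>
     (\<exists>T\<in>carrier (Aut M). AE x in M. rep T ` orbit G a x = orbit G b (rep T x))"

definition oe_class ::
    "('g, 'b) monoid_scheme \<Rightarrow> 'x measure \<Rightarrow>
       ('g \<Rightarrow> ('x \<Rightarrow> 'x) set) \<Rightarrow> ('g \<Rightarrow> ('x \<Rightarrow> 'x) set) set" where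
  "oe_class G M a = {b \<in> actions G M. orbit_equivalent G M a b}"

section \<open>Free groups\<close>

definition finitely_generated :: "('g, 'b) monoid_scheme \<Rightarrow> bool" where
  "finitely_generated G \<longleftrightarrow> (\<exists>F. finite F \<and> F \<subseteq> carrier G \<and> generate G F = carrier G)"

text \<open>A letter \<open>(s, True)\<close> stands for the generator \<open>s\<close>, and \<open>(s, False)\<close> for its formal inverse.\<close>

definition reduced_words :: "'g set \<Rightarrow> ('g \<times> bool) list set" where
  "reduced_words S =
     {w \<in> lists (S \<times> UNIV). successively (\<lambda>(s, i) (t, j). \<not> (s = t \<and> i \<noteq> j)) w}"

definition word_value :: "('g, 'b) monoid_scheme \<Rightarrow> ('g \<times> bool) list \<Rightarrow> 'g" where
  "word_value G w =
     foldr (\<lambda>(s, i) g. (if i then s else inv\<^bsub>G\<^esub> s) \<otimes>\<^bsub>G\<^esub> g) w \<one>\<^bsub>G\<^esub>"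

definition free_generating_set :: "('g, 'b) monoid_scheme \<Rightarrow> 'g set \<Rightarrow> bool" where
  "free_generating_set G S \<longleftrightarrow>
     S \<subseteq> carrier G \<and> bij_betw (word_value G) (reduced_words S) (carrier G)"

end

theory Submission
  imports Defs
begin

text \<open>
  Density holds because an ergodic automorphism \<open>T\<close> can be moved close to an arbitrary automorphism
  \<open>U\<close> by conjugating it inside its own full group, and such a conjugation does not change orbits.
  Indeed, if an automorphism \<open>W\<close> maps every point into its \<open>T\<close>-orbit, then \<open>W\<inverse> T W\<close> has exactly the orbits of \<open>T\<close>
  (\<open>conjugate_orbits\<close>). Given the action \<open>a\<close> and a target action \<open>b\<close>, replace each generator
  \<open>a s\<close> by such a conjugate \<open>c s\<close> close to \<open>b s\<close>. Since the group is free, \<open>c\<close> extends to an action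
  (\<open>free_extension\<close>). Its orbits are generated by the orbits of the \<open>c s\<close>, so they are those of \<open>a\<close>
  (\<open>AE_orbit_subset\<close>), and the identity is an orbit equivalence. Composition is continuous for the
  weak topology, so closeness on generators gives closeness on any finite set of group elements
  (\<open>holds_near_image_dist\<close>), which is all that the product topology tests.

  The core is therefore \<open>conjugate_approximation\<close>: given finitely many sets \<open>A\<close>, find \<open>W\<close> in the full
  group of \<open>T\<close> such that \<open>W\<inverse> T W A\<close> is close to \<open>U A\<close> for each of them. Label each point \<open>x\<close> by
  recording which \<open>A\<close> and which \<open>U A\<close> contain it; call the label \<open>p x\<close>. Two facts produce \<open>W\<close>.

  \<^item> \<open>simulating_labelling\<close>: some labelling \<open>q\<close> has the same distribution as \<open>p\<close>, and along \<open>T\<close> it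
  makes, outside a small set, only transitions that \<open>p\<close> makes along \<open>U\<close>. Take a Rokhlin tower for
  \<open>T\<close> (\<open>rokhlin_tower\<close>), cut its base into pieces whose relative measures are the probabilities of the
  possible label sequences along \<open>U\<close>-orbits, and write the corresponding sequence up the column over
  each piece. As \<open>U\<close> preserves the measure, each level then carries the distribution of \<open>p\<close>.

  \<^item> \<open>matching_automorphism\<close>: two finite labellings with the same distribution are carried to each
  other by an element of the full group of an ergodic automorphism (an exhaustion argument of Hopf).

  If \<open>q \<circ> W = p\<close>, then the transition property of \<open>q\<close> says that, up to a small set, \<open>W x\<close> lies in
  \<open>T W A\<close> if and only if \<open>x\<close> lies in \<open>U A\<close>.
\<close>

section \<open>Measure-preserving automorphisms\<close>

lemma mp_automorphismsD:
  assumes "T \<in> mp_automorphisms M"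
  shows mp_bij: "bij_betw T (space M) (space M)"
    and mp_measurable: "T \<in> measurable M M"
    and mp_inv_measurable: "inv_into (space M) T \<in> measurable M M"
    and mp_distr: "distr M M T = M"
  using assms by (auto simp: mp_automorphisms_def)

lemma mp_in_space: "T \<in> mp_automorphisms M \<Longrightarrow> x \<in> space M \<Longrightarrow> T x \<in> space M"
  using mp_bij bij_betwE by blast

lemma mp_inv_in_space:
  "T \<in> mp_automorphisms M \<Longrightarrow> x \<in> space M \<Longrightarrow> inv_into (space M) T x \<in> space M"
  by (meson mp_inv_measurable measurable_space)

lemma mp_inv_left:
  "T \<in> mp_automorphisms M \<Longrightarrow> x \<in> space M \<Longrightarrow> inv_into (space M) T (T x) = x"
  using mp_bij bij_betw_inv_into_left by metis

lemma mp_inv_right: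
  "T \<in> mp_automorphisms M \<Longrightarrow> x \<in> space M \<Longrightarrow> T (inv_into (space M) T x) = x"
  using mp_bij bij_betw_inv_into_right by metis

lemma mp_image_eq_vimage:
  assumes T: "T \<in> mp_automorphisms M" and B: "B \<subseteq> space M"
  shows "T ` B = {y \<in> space M. inv_into (space M) T y \<in> B}"
  using mp_inv_left[OF T] mp_inv_right[OF T] mp_in_space[OF T] B by force

lemma mp_image_sets:
  assumes T: "T \<in> mp_automorphisms M" and B: "B \<in> sets M"
  shows "T ` B \<in> sets M"
proof -
  have "T ` B = inv_into (space M) T -` B \<inter> space M"
    using mp_image_eq_vimage[OF T sets.sets_into_space[OF B]] by auto
  then show ?thesis using measurable_sets[OF mp_inv_measurable[OF T] B] by simp
qed

lemma mp_emeasure_vimage: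
  assumes T: "T \<in> mp_automorphisms M" and B: "B \<in> sets M"
  shows "emeasure M (T -` B \<inter> space M) = emeasure M B"
  using emeasure_distr[OF mp_measurable[OF T] B] mp_distr[OF T] by simp

lemma mp_emeasure_image:
  assumes T: "T \<in> mp_automorphisms M" and B: "B \<in> sets M"
  shows "emeasure M (T ` B) = emeasure M B"
proof -
  have "T -` (T ` B) \<inter> space M = B"
    using sets.sets_into_space[OF B] mp_inv_left[OF T] by (auto, metis subsetD)
  then show ?thesis
    using mp_emeasure_vimage[OF T mp_image_sets[OF T B]] by simp
qed

lemma mp_measure_image:
  "T \<in> mp_automorphisms M \<Longrightarrow> B \<in> sets M \<Longrightarrow> measure M (T ` B) = measure M B"
  by (simp add: mp_emeasure_image measure_def)

lemma mp_measure_vimage: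
  "T \<in> mp_automorphisms M \<Longrightarrow> B \<in> sets M \<Longrightarrow> measure M (T -` B \<inter> space M) = measure M B"
  by (simp add: mp_emeasure_vimage measure_def)

lemma mp_measure_pullback:
  assumes "T \<in> mp_automorphisms M" "{x \<in> space M. P x} \<in> sets M"
  shows "measure M {x \<in> space M. P (T x)} = measure M {x \<in> space M. P x}"
proof -
  have "T -` {x \<in> space M. P x} \<inter> space M = {x \<in> space M. P (T x)}"
    using mp_in_space[OF assms(1)] by auto
  then show ?thesis using mp_measure_vimage[OF assms] by simp
qed

lemma mp_sets_pullback:
  assumes "T \<in> mp_automorphisms M" "{x \<in> space M. P x} \<in> sets M"
  shows "{x \<in> space M. P (T x)} \<in> sets M"
proof -
  have "T -` {x \<in> space M. P x} \<inter> space M = {x \<in> space M. P (T x)}"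
    using mp_in_space[OF assms(1)] by auto
  then show ?thesis using measurable_sets[OF mp_measurable[OF assms(1)] assms(2)] by simp
qed

lemma mp_AE_pullback:
  assumes T: "T \<in> mp_automorphisms M" and P: "AE x in M. P x"
  shows "AE x in M. P (T x)"
proof (rule AE_distrD[OF mp_measurable[OF T]])
  show "AE x in distr M M T. P x" using P unfolding mp_distr[OF T] .
qed

text \<open>
  Measurability of the inverse and preservation of measure are both tested on images: full group
  elements are glued from pieces of powers of one automorphism, and images of pieces are easy to
  describe, unlike inverses.
\<close>

lemma mp_automorphismsI:
  assumes bij: "bij_betw T (space M) (space M)"
    and meas: "T \<in> measurable M M"
    and img: "\<And>B. B \<in> sets M \<Longrightarrow> T ` B \<in> sets M"
    and pres: "\<And>B. B \<in> sets M \<Longrightarrow> emeasure M (T ` B) = emeasure M B"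
  shows "T \<in> mp_automorphisms M"
proof -
  have inj: "inj_on T (space M)" and surj: "T ` space M = space M"
    using bij by (auto simp: bij_betw_def)
  have "inv_into (space M) T -` B \<inter> space M = T ` B" if "B \<in> sets M" for B
    using sets.sets_into_space[OF that] bij bij_betw_inv_into_left[OF bij]
      bij_betw_inv_into_right[OF bij] surj
    by (auto simp: image_iff) (metis subsetD imageI)+
  then have "inv_into (space M) T \<in> measurable M M"
    using img surj by (intro measurableI) (auto intro: inv_into_into)
  moreover have "distr M M T = M"
  proof (rule measure_eqI)
    fix B assume "B \<in> sets (distr M M T)"
    then have B: "B \<in> sets M" by simp
    have "B \<subseteq> T ` space M" using sets.sets_into_space[OF B] surj by simp
    then have "T ` (T -` B \<inter> space M) = B" by blast
    then show "emeasure (distr M M T) B = emeasure M B"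
      using pres[OF measurable_sets[OF meas B]] emeasure_distr[OF meas B] by simp
  qed simp
  ultimately show ?thesis using bij meas by (simp add: mp_automorphisms_def)
qed

lemma mp_id: "id \<in> mp_automorphisms M"
  by (rule mp_automorphismsI) auto

lemma mp_comp:
  assumes S: "S \<in> mp_automorphisms M" and T: "T \<in> mp_automorphisms M"
  shows "S \<circ> T \<in> mp_automorphisms M"
proof (rule mp_automorphismsI)
  show "bij_betw (S \<circ> T) (space M) (space M)"
    using bij_betw_trans[OF mp_bij[OF T] mp_bij[OF S]] .
  show "S \<circ> T \<in> measurable M M"
    using measurable_comp[OF mp_measurable[OF T] mp_measurable[OF S]] .
  show "(S \<circ> T) ` B \<in> sets M" if "B \<in> sets M" for B
    using mp_image_sets[OF S mp_image_sets[OF T that]] by (simp add: image_comp)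
  show "emeasure M ((S \<circ> T) ` B) = emeasure M B" if "B \<in> sets M" for B
    using mp_emeasure_image[OF S mp_image_sets[OF T that]] mp_emeasure_image[OF T that]
    by (simp add: image_comp)
qed

lemma mp_inv:
  assumes T: "T \<in> mp_automorphisms M"
  shows "inv_into (space M) T \<in> mp_automorphisms M"
proof (rule mp_automorphismsI)
  have img: "inv_into (space M) T ` B = T -` B \<inter> space M" if "B \<in> sets M" for B
    using sets.sets_into_space[OF that] mp_inv_left[OF T] mp_inv_right[OF T] mp_inv_in_space[OF T]
    by (auto simp: image_iff) (metis subsetD)+
  show "bij_betw (inv_into (space M) T) (space M) (space M)"
    by (rule bij_betw_inv_into[OF mp_bij[OF T]])
  show "inv_into (space M) T \<in> measurable M M"
    by (rule mp_inv_measurable[OF T])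
  show "inv_into (space M) T ` B \<in> sets M" if "B \<in> sets M" for B
    using measurable_sets[OF mp_measurable[OF T] that] img[OF that] by simp
  show "emeasure M (inv_into (space M) T ` B) = emeasure M B" if "B \<in> sets M" for B
    using mp_emeasure_vimage[OF T that] img[OF that] by simp
qed

section \<open>Integer powers\<close>

text \<open>
  Integer iterates of a bijection of \<open>X\<close>; the values at points outside \<open>X\<close> carry no information,
  because \<open>inv_into X T\<close> inverts \<open>T\<close> on \<open>X\<close> only.
\<close>

definition zpow :: "'x set \<Rightarrow> ('x \<Rightarrow> 'x) \<Rightarrow> int \<Rightarrow> 'x \<Rightarrow> 'x" where
  "zpow X T n = (if n \<ge> 0 then T ^^ nat n else inv_into X T ^^ nat (- n))"

lemma zpow_0 [simp]: "zpow X T 0 x = x" by (simp add: zpow_def)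

lemma zpow_1 [simp]: "zpow X T 1 x = T x" by (simp add: zpow_def)

lemma zpow_mp: 
  assumes "T \<in> mp_automorphisms M"
  shows "zpow (space M) T n \<in> mp_automorphisms M"
proof -
  have pow: "S ^^ k \<in> mp_automorphisms M" if "S \<in> mp_automorphisms M" for S k
  proof (induction k)
    case 0 then show ?case using mp_id by (simp add: id_def)
  next
    case (Suc k) then show ?case using mp_comp[OF that, of "S ^^ k"] by (simp only: funpow.simps)
  qed
  show ?thesis using pow[OF assms] pow[OF mp_inv[OF assms]] by (simp add: zpow_def)
qed

lemma zpow_in_space:
  "T \<in> mp_automorphisms M \<Longrightarrow> x \<in> space M \<Longrightarrow> zpow (space M) T n x \<in> space M"
  using mp_in_space zpow_mp by metis

lemma zpow_step:
  assumes T: "T \<in> mp_automorphisms M" and x: "x \<in> space M"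
  shows "zpow (space M) T (n + 1) x = T (zpow (space M) T n x)"
proof (cases "n \<ge> 0")
  case True
  then have "nat (n + 1) = Suc (nat n)" by simp
  then show ?thesis using True by (simp add: zpow_def)
next
  case False
  define k where "k = nat (- n - 1)"
  have n: "n = - int k - 1" using False k_def by simp
  have 1: "zpow (space M) T (n + 1) x = (inv_into (space M) T ^^ k) x"
    unfolding n by (simp add: zpow_def)
  have 2: "zpow (space M) T n x = inv_into (space M) T ((inv_into (space M) T ^^ k) x)"
  proof -
    have "nat (- n) = Suc k" using n by simp
    then show ?thesis using False by (simp add: zpow_def)
  qed
  have "(inv_into (space M) T ^^ k) x \<in> space M"
    using zpow_in_space[OF T x, of "n + 1"] 1 by simp
  then show ?thesis using 1 2 mp_inv_right[OF T] by simp
qed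

lemma zpow_step_back:
  assumes T: "T \<in> mp_automorphisms M" and x: "x \<in> space M"
  shows "zpow (space M) T (n - 1) x = inv_into (space M) T (zpow (space M) T n x)"
  using zpow_step[OF assms, of "n - 1"] mp_inv_left[OF T zpow_in_space[OF assms]] by simp

lemma zpow_add:
  assumes T: "T \<in> mp_automorphisms M" and x: "x \<in> space M"
  shows "zpow (space M) T (m + n) x = zpow (space M) T m (zpow (space M) T n x)"
proof (induction m rule: int_induct[where k = 0])
  case base then show ?case by simp
next
  case (step1 m)
  have "zpow (space M) T (m + 1 + n) x = zpow (space M) T ((m + n) + 1) x" by (simp add: ac_simps)
  then show ?case
    using step1 zpow_step[OF T x] zpow_step[OF T zpow_in_space[OF T x]] by simp
next
  case (step2 m)
  have "zpow (space M) T (m - 1 + n) x = zpow (space M) T ((m + n) - 1) x" by (simp add: algebra_simps)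
  then show ?case
    using step2 zpow_step_back[OF T x] zpow_step_back[OF T zpow_in_space[OF T x]] by simp
qed

lemma zpow_cancel:
  assumes "T \<in> mp_automorphisms M" "x \<in> space M"
  shows "zpow (space M) T n (zpow (space M) T (- n) x) = x"
    and "zpow (space M) T (- n) (zpow (space M) T n x) = x"
  using zpow_add[OF assms, of n "- n"] zpow_add[OF assms, of "- n" n] by simp_all

section \<open>Ergodic automorphisms and Rokhlin towers\<close>

locale ergodic_automorphism = prob_space M for M :: "'x measure" +
  fixes T :: "'x \<Rightarrow> 'x"
  assumes T: "T \<in> mp_automorphisms M"
    and invariant_trivial:
      "B \<in> sets M \<Longrightarrow> prob (sym_diff (T ` B) B) = 0 \<Longrightarrow> prob B = 0 \<or> prob B = 1"
begin

abbreviation \<tau> :: "int \<Rightarrow> 'x \<Rightarrow> 'x" where "\<tau> \<equiv> zpow (space M) T"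

lemmas \<tau>_mp = zpow_mp[OF T]
lemmas \<tau>_in_space = zpow_in_space[OF T]
lemmas \<tau>_add = zpow_add[OF T]
lemmas \<tau>_cancel = zpow_cancel[OF T]

lemma
  assumes "E \<in> sets M"
  shows \<tau>_vimage_sets: "{x \<in> space M. \<tau> n x \<in> E} \<in> sets M"
    and \<tau>_vimage_prob: "prob {x \<in> space M. \<tau> n x \<in> E} = prob E"
proof -
  have "{x \<in> space M. x \<in> E} = E" using sets.sets_into_space[OF assms] by auto
  then show "{x \<in> space M. \<tau> n x \<in> E} \<in> sets M" "prob {x \<in> space M. \<tau> n x \<in> E} = prob E"
    using mp_sets_pullback[OF \<tau>_mp, of "\<lambda>x. x \<in> E"] mp_measure_pullback[OF \<tau>_mp, of "\<lambda>x. x \<in> E"]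
      assms by simp_all
qed

text \<open>
  The set of points whose backward orbit meets \<open>E\<close> is mapped into itself by \<open>T\<close>. As \<open>T\<close>
  preserves the finite measure, that set is invariant up to a null set, so ergodicity makes it
  conull.
\<close>

lemma AE_backward_orbit_hits:
  assumes E: "E \<in> sets M" and pos: "prob E > 0"
  shows "AE x in M. \<exists>n::nat. \<tau> (- int n) x \<in> E"
proof -
  define F where "F = {x \<in> space M. \<exists>n::nat. \<tau> (- int n) x \<in> E}"
  have "F = (\<Union>n::nat. {x \<in> space M. \<tau> (- int n) x \<in> E})" by (auto simp: F_def)
  then have F: "F \<in> sets M" using \<tau>_vimage_sets[OF E] by auto
  have sub: "T ` F \<subseteq> F"
  proof
    fix y assume "y \<in> T ` F"
    then obtain x n where x: "x \<in> space M" "\<tau> (- int n) x \<in> E" "y = T x" by (auto simp: F_def)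
    have "\<tau> (- int (Suc n)) (\<tau> 1 x) = \<tau> (- int n) x"
      using \<tau>_add[OF x(1), of "- int (Suc n)" 1] by simp
    then have "\<tau> (- int (Suc n)) y \<in> E" using x by simp
    then show "y \<in> F" unfolding F_def using mp_in_space[OF T x(1)] x(3) by blast
  qed
  have "prob (sym_diff (T ` F) F) = prob (F - T ` F)"
    using sub by (simp add: Diff_eq_empty_iff[THEN iffD2])
  also have "\<dots> = 0"
    using finite_measure_Diff[OF F mp_image_sets[OF T F] sub] mp_measure_image[OF T F] by simp
  finally have "prob F = 0 \<or> prob F = 1" by (rule invariant_trivial[OF F])
  moreover have "E \<subseteq> F"
  proof
    fix x assume "x \<in> E"
    then show "x \<in> F" using sets.sets_into_space[OF E] unfolding F_def
      by (auto intro: exI[of _ "0::nat"])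
  qed
  then have "prob E \<le> prob F" by (rule finite_measure_mono[OF _ F])
  ultimately have "prob F = 1" using pos by linarith
  then have "AE x in M. x \<in> F" using prob_eq_1[OF F] by simp
  then show ?thesis by (rule AE_mp) (auto simp: F_def)
qed

text \<open>
  The point \<open>x\<close> lies on level \<open>i\<close> of the tower over \<open>B\<close> when \<open>\<tau> (- int i) x \<in> B\<close>. Classify
  points by the time \<open>r x\<close> elapsed since their last visit to \<open>E\<close>, which is finite almost
  everywhere. It grows by one along \<open>T\<close> until the next visit, so each stretch between visits can
  be cut into blocks of length \<open>N\<close>: level \<open>i\<close> consists of points with \<open>r x mod N = i\<close>. Only
  incomplete blocks are lost, and their points visit \<open>E\<close> within fewer than \<open>N\<close> steps, which
  bounds their measure by \<open>N * prob E\<close>. A small \<open>E\<close> thus gives an arbitrarily small remainder.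
\<close>

lemma rokhlin_tower:
  assumes E: "E \<in> sets M" "prob E > 0" and N: "N > (0::nat)"
  shows "\<exists>B\<in>sets M. 
     (\<forall>x\<in>space M. \<forall>i<N. \<forall>j<N. \<tau> (- int i) x \<in> B \<longrightarrow> \<tau> (- int j) x \<in> B \<longrightarrow> i = j) \<and>
     prob {x \<in> space M. \<forall>i<N. \<tau> (- int i) x \<notin> B} \<le> N * prob E"
proof -
  \<comment> \<open>\<open>V n\<close> is the set where \<open>r x = n\<close>.\<close>
  define V where "V n = {x \<in> space M. \<tau> (- int n) x \<in> E \<and> (\<forall>m<n. \<tau> (- int m) x \<notin> E)}" for n
  have V: "V n \<in> sets M" for n
  proof -
    have "V n = {x \<in> space M. \<tau> (- int n) x \<in> E} - (\<Union>m\<in>{..<n}. {x \<in> space M. \<tau> (- int m) x \<in> E})"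
      by (auto simp: V_def)
    then show ?thesis using \<tau>_vimage_sets[OF E(1)] by auto
  qed
  have V_unique: "n = m" if "x \<in> V n" "x \<in> V m" for x n m
    using that by (metis (mono_tags, lifting) V_def mem_Collect_eq linorder_neqE_nat)
  have V_shift: "x \<in> V (n - m)" if "x \<in> space M" "\<tau> (int m) x \<in> V n" "m \<le> n" for x n m
  proof -
    have eq: "\<tau> (- int k) x = \<tau> (- int (k + m)) (\<tau> (int m) x)" for k
      using \<tau>_add[OF that(1), of "- int (k + m)" "int m"] by simp
    have "\<tau> (- int (n - m)) x \<in> E"
      using eq[of "n - m"] that by (simp add: V_def)
    moreover have "\<tau> (- int k) x \<notin> E" if "k < n - m" for k
    proof -
      have "k + m < n" using that by simp
      then have "\<tau> (- int (k + m)) (\<tau> (int m) x) \<notin> E"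
        using \<open>\<tau> (int m) x \<in> V n\<close> by (auto simp only: V_def)
      then show ?thesis unfolding eq[of k] .
    qed
    ultimately show ?thesis using that(1) by (simp add: V_def)
  qed
  \<comment> \<open>Testing the top level at time \<open>k * N + (N - 1)\<close> keeps exactly the complete blocks.\<close>
  define B where "B = {x \<in> space M. \<exists>k. \<tau> (int (N - 1)) x \<in> V (k * N + (N - 1))}"
  have "B = (\<Union>k. {x \<in> space M. \<tau> (int (N - 1)) x \<in> V (k * N + (N - 1))})" by (auto simp: B_def)
  then have B: "B \<in> sets M" using \<tau>_vimage_sets[OF V] by auto
  have level: "\<tau> (- int i) x \<in> B \<longleftrightarrow> (\<exists>k. \<tau> (int (N - 1 - i)) x \<in> V (k * N + (N - 1)))"
    if "x \<in> space M" "i < N" for x i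
  proof -
    have "int (N - 1) + (- int i) = int (N - 1 - i)" using that(2) by (simp add: of_nat_diff)
    then have "\<tau> (int (N - 1)) (\<tau> (- int i) x) = \<tau> (int (N - 1 - i)) x"
      using \<tau>_add[OF that(1), of "int (N - 1)" "- int i"] by (simp only:)
    then show ?thesis using \<tau>_in_space[OF that(1)] by (simp add: B_def)
  qed
  have level_V: "\<exists>k. x \<in> V (k * N + i)" if x: "x \<in> space M" "i < N" "\<tau> (- int i) x \<in> B" for x i
  proof -
    obtain k where k: "\<tau> (int (N - 1 - i)) x \<in> V (k * N + (N - 1))" using level x by blast
    have "x \<in> V (k * N + (N - 1) - (N - 1 - i))" using V_shift[OF x(1) k] by simp
    moreover have "k * N + (N - 1) - (N - 1 - i) = k * N + i" using x(2) by simp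
    ultimately show ?thesis by auto
  qed
  have disj: "i = j" if d: "x \<in> space M" "i < N" "j < N" "\<tau> (- int i) x \<in> B" "\<tau> (- int j) x \<in> B" for x i j
  proof -
    obtain k l where "x \<in> V (k * N + i)" "x \<in> V (l * N + j)"
      using level_V[OF d(1,2,4)] level_V[OF d(1,3,5)] by blast
    then have "k * N + i = l * N + j" by (rule V_unique)
    then have "(k * N + i) mod N = (l * N + j) mod N" by simp
    then show ?thesis using d by simp
  qed
  define C where "C = (\<Union>j\<in>{..<N}. {x \<in> space M. \<tau> (int j) x \<in> E})"
  have C: "C \<in> sets M" using \<tau>_vimage_sets[OF E(1)] by (auto simp: C_def)
  have "prob C \<le> (\<Sum>j<N. prob {x \<in> space M. \<tau> (int j) x \<in> E})"
    unfolding C_def by (rule measure_UNION_le) (auto intro: \<tau>_vimage_sets[OF E(1)])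
  then have prob_C: "prob C \<le> N * prob E" using \<tau>_vimage_prob[OF E(1)] by simp
  have rest: "x \<in> C" if x: "x \<in> space M" "\<forall>i<N. \<tau> (- int i) x \<notin> B" and hit: "\<exists>n::nat. \<tau> (- int n) x \<in> E"
    for x
  proof -
    define n where "n = (LEAST n. \<tau> (- int n) x \<in> E)"
    have n: "x \<in> V n" unfolding V_def n_def
      using x(1) LeastI_ex[OF hit] not_less_Least by fastforce
    define k i where "k = n div N" and "i = n mod N"
    have i: "i < N" and nki: "n = k * N + i" using N by (auto simp: i_def k_def)
    have eq: "\<tau> (- int m) (\<tau> (int (N - 1 - i)) x) = \<tau> (int (N - 1 - i) - int m) x" for m
      using \<tau>_add[OF x(1), of "- int m" "int (N - 1 - i)"] by simp
    have "\<tau> (int (N - 1 - i)) x \<notin> V (k * N + (N - 1))" using x(2) level[OF x(1) i] i by blast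
    moreover have "\<tau> (- int (k * N + (N - 1))) (\<tau> (int (N - 1 - i)) x) \<in> E"
    proof -
      have "int (N - 1 - i) - int (k * N + (N - 1)) = - int n" using i nki by (simp add: of_nat_diff)
      then show ?thesis using eq[of "k * N + (N - 1)"] n by (simp add: V_def)
    qed
    ultimately obtain m where m: "\<tau> (- int m) (\<tau> (int (N - 1 - i)) x) \<in> E" "m < k * N + (N - 1)"
      using \<tau>_in_space[OF x(1)] by (auto simp: V_def)
    \<comment> \<open>Going back at least \<open>N - 1 - i\<close> steps from the top level passes \<open>x\<close>, so the visit would
      precede \<open>x\<close> by fewer than \<open>n\<close> steps.\<close>
    have "m < N - 1 - i"
    proof (rule ccontr)
      assume "\<not> m < N - 1 - i"
      then have le: "N - 1 - i \<le> m" by simp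
      then have "int (N - 1 - i) - int m = - int (m - (N - 1 - i))" by simp
      then have "\<tau> (- int (m - (N - 1 - i))) x \<in> E" using m(1) unfolding eq[of m] by (simp only:)
      moreover have "m - (N - 1 - i) < n" using le m(2) nki i by linarith
      ultimately show False using n by (simp add: V_def)
    qed
    then have "int (N - 1 - i) - int m = int (N - 1 - i - m)" by simp
    then have "\<tau> (int (N - 1 - i - m)) x \<in> E" using m(1) unfolding eq[of m] by (simp only:)
    moreover have "N - 1 - i - m < N" using N by simp
    ultimately show ?thesis using x(1) unfolding C_def by blast
  qed
  have "prob {x \<in> space M. \<forall>i<N. \<tau> (- int i) x \<notin> B} \<le> prob C"
  proof (rule finite_measure_mono_AE[OF _ C])
    show "AE x in M. x \<in> {x \<in> space M. \<forall>i<N. \<tau> (- int i) x \<notin> B} \<longrightarrow> x \<in> C"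
      using AE_backward_orbit_hits[OF E] by eventually_elim (use rest in blast)
  qed
  then show ?thesis using B disj prob_C by (intro bexI[of _ B]) auto
qed

end

section \<open>Subsets of prescribed measure\<close>

context prob_space
begin

text \<open>
  Of a proper subset of intermediate measure and its complement, one has at most half the
  measure. Iterating the halving gives arbitrarily small sets of positive measure.
\<close>

lemma non_atomic_small_subset:
  assumes na: "non_atomic M" and A: "A \<in> sets M" "prob A > 0" and e: "e > 0"
  shows "\<exists>B\<in>sets M. B \<subseteq> A \<and> 0 < prob B \<and> prob B < e"
proof -
  have half: "\<exists>C\<in>sets M. C \<subseteq> B \<and> 0 < prob C \<and> prob C \<le> prob B / 2"
    if B: "B \<in> sets M" "prob B > 0" for B
  proof -
    obtain C where C: "C \<in> sets M" "C \<subseteq> B" "0 < prob C" "prob C < prob B"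
      using na B unfolding non_atomic_def by blast
    have diff: "prob (B - C) = prob B - prob C" using finite_measure_Diff B C by blast
    show ?thesis
    proof (cases "prob C \<le> prob B / 2")
      case False
      then show ?thesis using B C diff by (intro bexI[of _ "B - C"]) auto
    qed (use C in blast)
  qed
  have iter: "\<exists>B\<in>sets M. B \<subseteq> A \<and> 0 < prob B \<and> prob B \<le> prob A / 2 ^ n" for n :: nat
  proof (induction n)
    case 0 then show ?case using A by auto
  next
    case (Suc n)
    then obtain B where B: "B \<in> sets M" "B \<subseteq> A" "0 < prob B" "prob B \<le> prob A / 2 ^ n" by blast
    obtain C where "C \<in> sets M" "C \<subseteq> B" "0 < prob C" "prob C \<le> prob B / 2" using half B by blast
    then show ?case using B by (intro bexI[of _ C]) auto
  qed
  obtain n where n: "(1/2) ^ n < e" using real_arch_pow_inv[OF e, of "1/2"] by auto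
  obtain B where B: "B \<in> sets M" "B \<subseteq> A" "0 < prob B" "prob B \<le> prob A / 2 ^ n" using iter by blast
  have "prob A / 2 ^ n \<le> (1/2) ^ n" using prob_le_1[of A] by (simp add: power_divide divide_right_mono)
  then show ?thesis using B n by (intro bexI[of _ B]) auto
qed

text \<open>
  Sierpinski's theorem, by greedy exhaustion: keep adding a set that still fits below \<open>t\<close> and
  whose measure is at least half of the best possible. If the union stayed below \<open>t\<close>, some set
  of positive measure would fit at every stage, and the added pieces would have measure bounded
  away from zero.
\<close>

lemma non_atomic_subset_of_measure:
  assumes na: "non_atomic M" and A: "A \<in> sets M" and t: "0 \<le> t" "t \<le> prob A"
  shows "\<exists>B\<in>sets M. B \<subseteq> A \<and> prob B = t"
proof -
  define cand where "cand B = {C \<in> sets M. C \<subseteq> A - B \<and> prob C \<le> t - prob B}" for B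
  define good where "good B C \<longleftrightarrow> C \<in> cand B \<and> (\<forall>D\<in>cand B. prob D \<le> 2 * prob C)" for B C
  have ex: "\<exists>C. good B C" if "prob B \<le> t" for B
  proof -
    have e: "{} \<in> cand B" using that by (simp add: cand_def)
    have bdd: "bdd_above (prob ` cand B)" by (rule bdd_aboveI2[of _ _ 1]) simp
    define s where "s = (SUP C\<in>cand B. prob C)"
    have le: "prob D \<le> s" if "D \<in> cand B" for D
      unfolding s_def by (rule cSUP_upper[OF that bdd])
    show ?thesis
    proof (cases "s \<le> 0")
      case True
      then show ?thesis using e le by (intro exI[of _ "{}"]) (force simp: good_def)
    next
      case False
      then have "s / 2 < s" by simp
      then obtain C where "C \<in> cand B" "s / 2 < prob C"
        unfolding s_def using less_cSUP_iff[OF _ bdd] e by blast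
      then show ?thesis using le by (intro exI[of _ C]) (force simp: good_def)
    qed
  qed
  define step where "step B = B \<union> (SOME C. good B C)" for B
  define b where "b n = (step ^^ n) {}" for n
  define c where "c n = (SOME C. good (b n) C)" for n
  have b_Suc: "b (Suc n) = b n \<union> c n" for n by (simp add: b_def c_def step_def)
  have inv: "b n \<in> sets M \<and> b n \<subseteq> A \<and> prob (b n) \<le> t" for n
  proof (induction n)
    case 0 then show ?case using t by (simp add: b_def)
  next
    case (Suc n)
    then have "good (b n) (c n)" unfolding c_def using someI_ex[OF ex] by blast
    then have c: "c n \<in> sets M" "c n \<subseteq> A - b n" "prob (c n) \<le> t - prob (b n)"
      by (auto simp: good_def cand_def)
    then have "prob (b n \<union> c n) = prob (b n) + prob (c n)"
      using Suc by (intro finite_measure_Union) auto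
    then show ?case using Suc c by (auto simp: b_Suc)
  qed
  have good: "good (b n) (c n)" for n unfolding c_def using someI_ex[OF ex] inv by blast
  then have c: "c n \<in> sets M" "c n \<subseteq> A - b n" "prob (c n) \<le> t - prob (b n)" for n
    by (auto simp: good_def cand_def)
  have inc: "incseq b" by (rule incseq_SucI) (auto simp: b_Suc)
  define B where "B = (\<Union>n. b n)"
  have B: "B \<in> sets M" "B \<subseteq> A" using inv by (auto simp: B_def)
  have lim: "(\<lambda>n. prob (b n)) \<longlonglongrightarrow> prob B"
    unfolding B_def by (rule finite_Lim_measure_incseq) (use inv inc in auto)
  have "prob B \<le> t" using LIMSEQ_le_const2[OF lim] inv by blast
  moreover have "\<not> prob B < t"
  proof
    assume less: "prob B < t"
    have "prob (A - B) > 0" using finite_measure_Diff[OF A B] less t by simp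
    then obtain C where C: "C \<in> sets M" "C \<subseteq> A - B" "0 < prob C" "prob C < t - prob B"
      using non_atomic_small_subset[OF na _ _, of "A - B" "t - prob B"] A B less by auto
    have bB: "b n \<subseteq> B" for n by (auto simp: B_def)
    have "C \<in> cand (b n)" for n
      using C bB[of n] finite_measure_mono[OF bB[of n] B(1)] by (auto simp: cand_def)
    then have low: "prob C / 2 \<le> prob (c n)" for n using good[of n] by (fastforce simp: good_def)
    have grow: "prob (b n) \<ge> n * (prob C / 2)" for n
    proof (induction n)
      case 0 then show ?case by simp
    next
      case (Suc n)
      have "prob (b (Suc n)) = prob (b n) + prob (c n)"
        unfolding b_Suc using inv c[of n] by (intro finite_measure_Union) auto
      then show ?case using Suc low[of n] by (simp add: algebra_simps)
    qed
    obtain n :: nat where "1 < n * (prob C / 2)" using ex_less_of_nat_mult[of "prob C / 2" 1] C(3) by auto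
    then show False using grow[of n] prob_le_1[of "b n"] by linarith
  qed
  ultimately show ?thesis using B by (intro bexI[of _ B]) auto
qed

text \<open>
  Cut off the pieces one after the other. The result is given as a labelling because the pieces
  are later indexed by labels and by sequences of labels.
\<close>

lemma non_atomic_labelling:
  assumes na: "non_atomic M" and I: "finite I" "I \<noteq> {}"
    and B: "B \<in> sets M" and w: "\<And>i. i \<in> I \<Longrightarrow> w i \<ge> 0" "(\<Sum>i\<in>I. w i) = prob B"
  shows "\<exists>d. (\<forall>x. d x \<in> I) \<and> (\<forall>i\<in>I. {x \<in> B. d x = i} \<in> sets M \<and> prob {x \<in> B. d x = i} = w i)"
  using I B w
proof (induction I arbitrary: B rule: finite_ne_induct)
  case (singleton i)
  then show ?case by (intro exI[of _ "\<lambda>_. i"]) simp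
next
  case (insert i I)
  have "w i \<le> prob B" using insert sum_nonneg[of I w] by simp
  then obtain C where C: "C \<in> sets M" "C \<subseteq> B" "prob C = w i"
    using non_atomic_subset_of_measure[OF na insert.prems(1), of "w i"] insert.prems(2) by auto
  have "(\<Sum>j\<in>I. w j) = prob (B - C)"
    using finite_measure_Diff[OF insert.prems(1) C(1,2)] insert.prems insert.hyps C(3) by simp
  then obtain d where d: "\<And>x. d x \<in> I"
      "\<And>j. j \<in> I \<Longrightarrow> {x \<in> B - C. d x = j} \<in> sets M \<and> prob {x \<in> B - C. d x = j} = w j"
    using insert.IH[of "B - C"] insert.prems C(1) by auto
  define d' where "d' x = (if x \<in> C then i else d x)" for x
  have "{x \<in> B. d' x = i} = C" using C(2) d(1) insert.hyps by (auto simp: d'_def)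
  moreover have "{x \<in> B. d' x = j} = {x \<in> B - C. d x = j}" if "j \<in> I" for j
    using that insert.hyps by (auto simp: d'_def)
  ultimately show ?case using C d by (intro exI[of _ d']) (auto simp: d'_def)
qed

end

section \<open>Matching labellings inside the full group\<close>

text \<open>
  A bijection that agrees on countably many measurable pieces with powers of \<open>T\<close> is again
  measure preserving: the images of the pieces are disjoint and have the measures of the pieces.
\<close>

lemma full_group_automorphism:
  fixes c :: "'x \<Rightarrow> int"
  assumes T: "T \<in> mp_automorphisms M"
    and c: "c \<in> measurable M (count_space UNIV)"
    and bij: "bij_betw (\<lambda>x. zpow (space M) T (c x) x) (space M) (space M)"
  shows "(\<lambda>x. zpow (space M) T (c x) x) \<in> mp_automorphisms M"
proof -
  define W where "W x = zpow (space M) T (c x) x" for x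
  have bijW: "bij_betw W (space M) (space M)" using bij by (simp add: W_def[abs_def])
  have split: "W ` B \<in> sets M \<and> emeasure M (W ` B) = emeasure M B" if B: "B \<in> sets M" for B
  proof -
    define P where "P n = B \<inter> {x \<in> space M. c x = n}" for n
    have P: "P n \<in> sets M" for n
    proof -
      have "c -` {n} \<inter> space M \<in> sets M" by (rule measurable_sets[OF c]) simp
      moreover have "P n = B \<inter> (c -` {n} \<inter> space M)" by (auto simp: P_def)
      ultimately show ?thesis using B by simp
    qed
    have B_eq: "B = (\<Union>n. P n)" using sets.sets_into_space[OF B] by (auto simp: P_def)
    have "W ` P n = zpow (space M) T n ` P n" for n
      by (rule image_cong) (auto simp: P_def W_def)
    then have WP: "W ` P n \<in> sets M" "emeasure M (W ` P n) = emeasure M (P n)" for n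
      using mp_image_sets[OF zpow_mp[OF T] P] mp_emeasure_image[OF zpow_mp[OF T] P] by simp_all
    have W_eq: "W ` B = (\<Union>n. W ` P n)" using B_eq by auto
    have disj: "disjoint_family P" by (auto simp: disjoint_family_on_def P_def)
    have "disjoint_family (\<lambda>n. W ` P n)"
      unfolding disjoint_family_on_def
    proof (intro ballI impI)
      fix m n :: int assume "m \<noteq> n"
      then have "P m \<inter> P n = {}" by (auto simp: P_def)
      moreover have "P m \<subseteq> space M" "P n \<subseteq> space M" by (auto simp: P_def)
      ultimately show "W ` P m \<inter> W ` P n = {}"
        using inj_on_image_Int[OF bij_betw_imp_inj_on[OF bijW], of "P m" "P n"] by simp
    qed
    then have "emeasure M (W ` B) = (\<integral>\<^sup>+n. emeasure M (W ` P n) \<partial>count_space UNIV)"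
      unfolding W_eq by (intro emeasure_UN_countable) (auto simp: WP)
    also have "\<dots> = emeasure M B"
      unfolding WP using emeasure_UN_countable[of UNIV P M] P disj by (simp add: B_eq[symmetric])
    finally show ?thesis using WP W_eq by auto
  qed
  have "W \<in> measurable M M"
    unfolding W_def by (rule measurable_compose_countable[OF _ c]) (rule mp_measurable[OF zpow_mp[OF T]])
  then have "W \<in> mp_automorphisms M"
    using bijW split by (intro mp_automorphismsI) auto
  then show ?thesis by (simp add: W_def[abs_def])
qed

context ergodic_automorphism
begin

text \<open>
  Hopf's exhaustion argument. Run through all integers \<open>n\<close> and, at each stage, match \<open>x\<close> with
  \<open>\<tau> n x\<close> whenever neither point is used yet and the labels agree. Each stage removes from the
  domain and from the range sets of equal measure for every label, so the unmatched parts have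
  equal measure for every label too. If these were positive, ergodicity would give an orbit that
  meets both unmatched parts of the same label, and the stage of the corresponding integer would
  have matched two of its points.
\<close>

lemma matching_automorphism:
  fixes p q :: "'x \<Rightarrow> 'l"
  assumes L: "finite L" and p_in: "\<And>x. x \<in> space M \<Longrightarrow> p x \<in> L"
    and q_in: "\<And>x. x \<in> space M \<Longrightarrow> q x \<in> L"
    and p: "\<And>l. l \<in> L \<Longrightarrow> {x \<in> space M. p x = l} \<in> sets M"
    and q: "\<And>l. l \<in> L \<Longrightarrow> {x \<in> space M. q x = l} \<in> sets M"
    and pq: "\<And>l. l \<in> L \<Longrightarrow> prob {x \<in> space M. p x = l} = prob {x \<in> space M. q x = l}"
  shows "\<exists>W\<in>mp_automorphisms M. (\<forall>x\<in>space M. \<exists>n. W x = \<tau> n x) \<and> (AE x in M. q (W x) = p x)"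
proof -
  \<comment> \<open>\<open>D\<close> and \<open>R\<close> are the parts of the domain and of the range that are used before stage \<open>k\<close>.\<close>
  define cand where "cand k D R =
    {x \<in> space M. x \<notin> D \<and> \<tau> (int_decode k) x \<notin> R \<and> q (\<tau> (int_decode k) x) = p x}" for k D R
  define DR where "DR = rec_nat ({}, {}) (\<lambda>k (D, R). 
     (D \<union> cand k D R, R \<union> \<tau> (int_decode k) ` cand k D R))"
  define D where "D k = fst (DR k)" for k
  define R where "R k = snd (DR k)" for k
  define P where "P k = cand k (D k) (R k)" for k
  have D0: "D 0 = {}" and R0: "R 0 = {}" by (simp_all add: D_def R_def DR_def)
  have D_Suc: "D (Suc k) = D k \<union> P k" and R_Suc: "R (Suc k) = R k \<union> \<tau> (int_decode k) ` P k" for k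
    by (simp_all add: D_def R_def P_def DR_def split: prod.splits)
  have P_iff: "x \<in> P k \<longleftrightarrow>
      x \<in> space M \<and> x \<notin> D k \<and> \<tau> (int_decode k) x \<notin> R k \<and> q (\<tau> (int_decode k) x) = p x" for x k
    by (simp add: P_def cand_def)
  have agree: "{x \<in> space M. q (\<tau> n x) = p x} \<in> sets M" for n
  proof -
    have "{x \<in> space M. q (\<tau> n x) = p x} = 
      (\<Union>l\<in>L. {x \<in> space M. p x = l} \<inter> {x \<in> space M. \<tau> n x \<in> {x \<in> space M. q x = l}})"
      using p_in \<tau>_in_space by auto
    also have "\<dots> \<in> sets M" using L p \<tau>_vimage_sets[OF q] by (intro sets.finite_UN) auto
    finally show ?thesis .
  qed
  have P_sets: "P k \<in> sets M" if "D k \<in> sets M" "R k \<in> sets M" for k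
  proof -
    have "P k = {x \<in> space M. q (\<tau> (int_decode k) x) = p x} - D k - {x \<in> space M. \<tau> (int_decode k) x \<in> R k}"
      by (auto simp: P_iff)
    then show ?thesis using agree \<tau>_vimage_sets that by simp
  qed
  have DR_sets: "D k \<in> sets M \<and> R k \<in> sets M" for k
  proof (induction k)
    case 0 then show ?case by (simp add: D0 R0)
  next
    case (Suc k)
    then have "P k \<in> sets M" using P_sets by blast
    then show ?case using Suc mp_image_sets[OF \<tau>_mp] by (auto simp: D_Suc R_Suc)
  qed
  note Ps = P_sets[OF DR_sets[THEN conjunct1] DR_sets[THEN conjunct2]]
  have R_eq: "R k = (\<Union>j<k. \<tau> (int_decode j) ` P j)" for k
    by (induction k) (auto simp: R0 R_Suc lessThan_Suc)
  have D_eq: "D k = (\<Union>j<k. P j)" for k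
    by (induction k) (auto simp: D0 D_Suc lessThan_Suc)
  have D_mono: "D j \<subseteq> D k" and R_mono: "R j \<subseteq> R k" if "j \<le> k" for j k
    unfolding D_eq R_eq using that by (intro UN_mono; auto)+
  have P_unique: "j = k" if "x \<in> P j" "x \<in> P k" for x j k
  proof (rule ccontr)
    assume "j \<noteq> k"
    then consider "j < k" | "k < j" by linarith
    then show False using that D_eq P_iff by cases blast+
  qed
  have target_unique: "j = k" if "x \<in> P j" "y \<in> P k" "\<tau> (int_decode j) x = \<tau> (int_decode k) y" for x y j k
  proof (rule ccontr)
    assume "j \<noteq> k"
    then consider "j < k" | "k < j" by linarith
    then show False
    proof cases
      case 1
      then have "\<tau> (int_decode j) x \<in> R k" using that(1) R_eq by blast
      then show False using that P_iff by simp
    next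
      case 2
      then have "\<tau> (int_decode k) y \<in> R j" using that(2) R_eq by blast
      then show False using that P_iff by simp
    qed
  qed
  define Dom where "Dom = (\<Union>k. D k)"
  define Ran where "Ran = (\<Union>k. R k)"
  have Dom: "Dom \<in> sets M" and Ran: "Ran \<in> sets M" using DR_sets by (auto simp: Dom_def Ran_def)
  have level: "prob (D k \<inter> {x \<in> space M. p x = l}) = prob (R k \<inter> {x \<in> space M. q x = l})"
    if l: "l \<in> L" for k l
  proof (induction k)
    case 0 then show ?case by (simp add: D0 R0)
  next
    case (Suc k)
    define Q where "Q = P k \<inter> {x \<in> space M. p x = l}"
    have Q: "Q \<in> sets M" using Ps p[OF l] by (simp add: Q_def)
    have img: "\<tau> (int_decode k) ` P k \<inter> {x \<in> space M. q x = l} = \<tau> (int_decode k) ` Q"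
      using P_iff \<tau>_in_space by (auto simp: Q_def)
    have "prob (D (Suc k) \<inter> {x \<in> space M. p x = l}) =
        prob (D k \<inter> {x \<in> space M. p x = l}) + prob Q"
      unfolding D_Suc Int_Un_distrib2 Q_def using DR_sets Ps p[OF l] P_iff
      by (intro finite_measure_Union) auto
    moreover have "prob (R (Suc k) \<inter> {x \<in> space M. q x = l}) =
        prob (R k \<inter> {x \<in> space M. q x = l}) + prob (\<tau> (int_decode k) ` Q)"
      unfolding R_Suc Int_Un_distrib2 img using DR_sets mp_image_sets[OF \<tau>_mp Q] q[OF l] P_iff
      by (intro finite_measure_Union) (auto simp: Q_def)
    ultimately show ?case using Suc mp_measure_image[OF \<tau>_mp Q] by simp
  qed
  have match: "prob (Dom \<inter> {x \<in> space M. p x = l}) = prob (Ran \<inter> {x \<in> space M. q x = l})"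
    if l: "l \<in> L" for l
  proof -
    have "(\<lambda>k. prob (D k \<inter> {x \<in> space M. p x = l})) \<longlonglongrightarrow> prob (\<Union>k. D k \<inter> {x \<in> space M. p x = l})"
    proof (rule finite_Lim_measure_incseq)
      show "incseq (\<lambda>k. D k \<inter> {x \<in> space M. p x = l})"
        unfolding incseq_def using D_mono by blast
    qed (use DR_sets p[OF l] in auto)
    moreover have "(\<lambda>k. prob (R k \<inter> {x \<in> space M. q x = l})) \<longlonglongrightarrow> prob (\<Union>k. R k \<inter> {x \<in> space M. q x = l})"
    proof (rule finite_Lim_measure_incseq)
      show "incseq (\<lambda>k. R k \<inter> {x \<in> space M. q x = l})"
        unfolding incseq_def using R_mono by blast
    qed (use DR_sets q[OF l] in auto)
    ultimately have "prob (\<Union>k. D k \<inter> {x \<in> space M. p x = l}) = prob (\<Union>k. R k \<inter> {x \<in> space M. q x = l})"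
      unfolding level[OF l] by (rule LIMSEQ_unique)
    then show ?thesis by (simp add: Dom_def Ran_def)
  qed
  define DL where "DL l = {x \<in> space M. p x = l} - Dom \<inter> {x \<in> space M. p x = l}" for l
  define RL where "RL l = {x \<in> space M. q x = l} - Ran \<inter> {x \<in> space M. q x = l}" for l
  have DLs: "DL l \<in> sets M" and RLs: "RL l \<in> sets M" if "l \<in> L" for l
    using Dom Ran p[OF that] q[OF that] by (auto simp: DL_def RL_def)
  have DL_RL: "prob (DL l) = prob (RL l)" if l: "l \<in> L" for l
    unfolding DL_def RL_def using Dom Ran p[OF l] q[OF l] match[OF l] pq[OF l]
    by (subst (1 2) finite_measure_Diff) auto
  have null: "prob (DL l) = 0" if l: "l \<in> L" for l
  proof (rule ccontr)
    assume "prob (DL l) \<noteq> 0"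
    then have pos: "prob (DL l) > 0" using zero_less_measure_iff by blast
    have hit: "AE x in M. \<exists>n::nat. \<tau> (- int n) x \<in> DL l" by (rule AE_backward_orbit_hits[OF DLs[OF l] pos])
    \<comment> \<open>The unmatched range has positive measure, so almost every backward orbit enters the
      unmatched domain from it.\<close>
    have "\<exists>x\<in>RL l. \<exists>n::nat. \<tau> (- int n) x \<in> DL l"
    proof (rule ccontr)
      assume "\<not> ?thesis"
      then have "AE x in M. x \<notin> RL l" using hit by (auto elim!: eventually_mono)
      then have "prob (RL l) = 0" using prob_eq_0[OF RLs[OF l]] by simp
      then show False using DL_RL[OF l] pos by simp
    qed
    then obtain x n where x: "x \<in> RL l" and n: "\<tau> (- int n) x \<in> DL l" by blast
    define z where "z = \<tau> (- int n) x"
    have xs: "x \<in> space M" using x by (auto simp: RL_def)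
    have zx: "\<tau> (int n) z = x" unfolding z_def using \<tau>_cancel(1)[OF xs] by simp
    obtain k where k: "int_decode k = int n" by (metis int_encode_inverse)
    have "z \<in> P k" using x n zx k
      by (auto simp: P_iff DL_def RL_def z_def[symmetric] Dom_def Ran_def)
    then have "z \<in> Dom" using D_Suc[of k] by (auto simp: Dom_def)
    then show False using n by (auto simp: z_def DL_def)
  qed
  have "AE x in M. \<forall>l\<in>L. x \<notin> DL l"
    using null DLs by (intro AE_finite_allI[OF L]) (auto simp: prob_eq_0[symmetric])
  moreover have "AE x in M. \<forall>l\<in>L. x \<notin> RL l"
    using null RLs DL_RL by (intro AE_finite_allI[OF L]) (auto simp: prob_eq_0[symmetric])
  ultimately have "AE x in M. x \<in> Dom \<inter> Ran"
    using AE_space by eventually_elim (use p_in q_in in \<open>auto simp: DL_def RL_def\<close>)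
  then have "AE x in M. \<tau> n x \<in> Dom \<inter> Ran" for n by (rule mp_AE_pullback[OF \<tau>_mp])
  then have AE_all: "AE x in M. \<forall>n. \<tau> n x \<in> Dom \<inter> Ran" by (simp add: AE_all_countable)
  \<comment> \<open>The matching is bijective only up to a null set. Restricting it to an invariant conull set
    and taking the identity elsewhere makes it a bijection of the whole space.\<close>
  define Z where "Z = {x \<in> space M. \<forall>n. \<tau> n x \<in> Dom \<inter> Ran}"
  have "Z = (\<Inter>n. {x \<in> space M. \<tau> n x \<in> Dom \<inter> Ran})" by (auto simp: Z_def)
  moreover have "\<dots> \<in> sets M"
    using \<tau>_vimage_sets[of "Dom \<inter> Ran"] Dom Ran by (intro sets.countable_INT) auto
  ultimately have Z: "Z \<in> sets M" by simp
  have Z_inv: "\<tau> n x \<in> Z \<longleftrightarrow> x \<in> Z" if x: "x \<in> space M" for n x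
  proof
    assume "x \<in> Z"
    then show "\<tau> n x \<in> Z" using \<tau>_in_space[OF x] by (auto simp: Z_def \<tau>_add[OF x, symmetric])
  next
    assume a: "\<tau> n x \<in> Z"
    have "\<tau> m x \<in> Dom \<inter> Ran" for m
    proof -
      have "\<tau> (m - n) (\<tau> n x) \<in> Dom \<inter> Ran" using a by (simp add: Z_def)
      then show ?thesis using \<tau>_add[OF x, of "m - n" n] by simp
    qed
    then show "x \<in> Z" using x by (simp add: Z_def)
  qed
  define c where "c x = (if x \<in> Z then int_decode (LEAST k. x \<in> P k) else 0)" for x
  have c_meas: "c \<in> measurable M (count_space UNIV)"
  proof -
    have [measurable]: "Measurable.pred M (\<lambda>x. x \<in> P k)" for k by (rule pred_sets2[OF Ps]) simp
    have "(\<lambda>x. LEAST k. x \<in> P k) \<in> measurable M (count_space UNIV)" by measurable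
    then have "(\<lambda>x. int_decode (LEAST k. x \<in> P k)) \<in> measurable M (count_space UNIV)"
      by (rule measurable_compose) simp
    then show ?thesis unfolding c_def
      using Z by (intro measurable_If_set) (auto simp: Int_absorb2 sets.sets_into_space)
  qed
  define W where "W x = \<tau> (c x) x" for x
  have W_P: "W x = \<tau> (int_decode k) x" if "x \<in> Z" "x \<in> P k" for x k
  proof -
    have "(LEAST k. x \<in> P k) = k" by (rule Least_equality) (use that P_unique in \<open>auto simp: eq_iff\<close>)
    then show ?thesis using that by (simp add: W_def c_def)
  qed
  have Z_P: "\<exists>k. x \<in> P k" if "x \<in> Z" for x
  proof -
    have "\<tau> 0 x \<in> Dom" using that unfolding Z_def by blast
    then show ?thesis by (auto simp: Dom_def D_eq)
  qed
  have W_off: "W x = x" if "x \<notin> Z" for x using that by (simp add: W_def c_def)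
  have W_Z: "W x \<in> Z \<longleftrightarrow> x \<in> Z" if "x \<in> space M" for x
    unfolding W_def by (rule Z_inv[OF that])
  have "bij_betw W (space M) (space M)"
    unfolding bij_betw_def
  proof (intro conjI inj_onI equalityI subsetI)
    fix x y assume xy: "x \<in> space M" "y \<in> space M" "W x = W y"
    show "x = y"
    proof (cases "x \<in> Z")
      case True
      then have yZ: "y \<in> Z" using W_Z xy by metis
      obtain j k where jk: "x \<in> P j" "y \<in> P k" using Z_P True yZ by blast
      then have eq: "\<tau> (int_decode j) x = \<tau> (int_decode k) y" using W_P True yZ xy(3) by simp
      then have "j = k" using target_unique jk by blast
      then show ?thesis using eq \<tau>_cancel(2) xy by metis
    next
      case False
      then show ?thesis using W_Z W_off xy by metis
    qed
  next
    fix y assume "y \<in> W ` space M"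
    then show "y \<in> space M" using \<tau>_in_space by (auto simp: W_def)
  next
    fix y assume y: "y \<in> space M"
    show "y \<in> W ` space M"
    proof (cases "y \<in> Z")
      case True
      have "\<tau> 0 y \<in> Ran" using True unfolding Z_def by blast
      then obtain j x where x: "x \<in> P j" "y = \<tau> (int_decode j) x" by (auto simp: Ran_def R_eq)
      then have "x \<in> space M" "x \<in> Z" using P_iff Z_inv True by auto
      then show ?thesis using W_P x by (metis imageI)
    next
      case False
      then show ?thesis using W_off y by (metis imageI)
    qed
  qed
  then have W: "W \<in> mp_automorphisms M"
    using full_group_automorphism[OF T c_meas] by (simp add: W_def[abs_def])
  have "AE x in M. q (W x) = p x"
    using AE_all AE_space
  proof eventually_elim
    case (elim x)
    then have "x \<in> Z" by (simp add: Z_def)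
    then obtain k where k: "x \<in> P k" using Z_P by blast
    show ?case using W_P[OF \<open>x \<in> Z\<close> k] k[unfolded P_iff] by simp
  qed
  then show ?thesis using W by (intro bexI[of _ W]) (auto simp: W_def)
qed

end

section \<open>Weak approximation by conjugates with the same orbits\<close>

lemma (in prob_space) prob_by_finite_label:
  assumes I: "finite I" and f: "\<And>x. x \<in> X \<Longrightarrow> f x \<in> I"
    and meas: "\<And>i. i \<in> I \<Longrightarrow> {x \<in> X. f x = i} \<in> sets M"
  shows "{x \<in> X. P (f x)} \<in> sets M"
    and "prob {x \<in> X. P (f x)} = (\<Sum>i\<in>{i\<in>I. P i}. prob {x \<in> X. f x = i})"
proof -
  have eq: "{x \<in> X. P (f x)} = (\<Union>i\<in>{i\<in>I. P i}. {x \<in> X. f x = i})" using f by auto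
  show "{x \<in> X. P (f x)} \<in> sets M" unfolding eq using I meas by (intro sets.finite_UN) auto
  show "prob {x \<in> X. P (f x)} = (\<Sum>i\<in>{i\<in>I. P i}. prob {x \<in> X. f x = i})"
    unfolding eq using I meas
    by (intro finite_measure_finite_Union) (auto simp: disjoint_family_on_def)
qed

lemma measurable_set_label:
  assumes "finite \<A>" "\<A> \<subseteq> sets M" "a \<subseteq> \<A>"
  shows "{x \<in> space M. {A \<in> \<A>. x \<in> A} = a} \<in> sets M"
proof -
  have "{x \<in> space M. {A \<in> \<A>. x \<in> A} = a} = {x \<in> space M. \<forall>A\<in>\<A>. x \<in> A \<longleftrightarrow> A \<in> a}"
    using assms(3) by auto
  also have "\<dots> \<in> sets M"
  proof (rule sets.sets_Collect_finite_All[OF _ assms(1)])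
    fix A assume "A \<in> \<A>"
    then have "A \<in> sets M" using assms(2) by blast
    moreover have "{x \<in> space M. x \<in> A \<longleftrightarrow> A \<in> a} = (if A \<in> a then A else space M - A)"
      using sets.sets_into_space[OF \<open>A \<in> sets M\<close>] by auto
    ultimately show "{x \<in> space M. x \<in> A \<longleftrightarrow> A \<in> a} \<in> sets M" by auto
  qed
  finally show ?thesis .
qed

context ergodic_automorphism
begin

text \<open>
  The labelling \<open>q\<close> imitates along \<open>T\<close> the process that \<open>p\<close> generates along \<open>U\<close>: outside \<open>Y\<close>,
  the labels of \<open>T\<inverse> y\<close> and \<open>y\<close> are those of \<open>z\<close> and \<open>U z\<close> for some \<open>z\<close>. Over the piece of the
  base of a Rokhlin tower that belongs to the sequence \<open>p x, p (U x), \<dots>, p (U^(N-1) x)\<close>, level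
  \<open>i\<close> gets the \<open>i\<close>-th entry. The pieces have measures proportional to the probabilities of the
  sequences, hence level \<open>i\<close> has the distribution of \<open>p \<circ> U^i\<close>, which is that of \<open>p\<close>. The
  remainder of the tower is labelled arbitrarily with the same distribution, so the overall
  distribution is exact.
\<close>

lemma simulating_labelling:
  fixes p :: "'x \<Rightarrow> 'l"
  assumes na: "non_atomic M" and U: "U \<in> mp_automorphisms M" and e: "e > 0"
    and L: "finite L" and p_in: "\<And>x. x \<in> space M \<Longrightarrow> p x \<in> L"
    and p: "\<And>l. l \<in> L \<Longrightarrow> {x \<in> space M. p x = l} \<in> sets M"
  obtains q Y where "\<And>x. x \<in> space M \<Longrightarrow> q x \<in> L"
    and "\<And>l. l \<in> L \<Longrightarrow> {x \<in> space M. q x = l} \<in> sets M"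
    and "\<And>l. l \<in> L \<Longrightarrow> prob {x \<in> space M. q x = l} = prob {x \<in> space M. p x = l}"
    and "Y \<in> sets M" and "prob Y < e"
    and "\<And>y. y \<in> space M - Y \<Longrightarrow> \<exists>z\<in>space M. q (\<tau> (-1) y) = p z \<and> q y = p (U z)"
proof -
  obtain N0 :: nat where N0: "1 / real (Suc N0) < e / 2" using nat_approx_posE[of "e / 2"] e by auto
  define N where "N = Suc N0"
  have N: "N > 0" "1 / real N < e / 2" using N0 by (auto simp: N_def)
  obtain E where E: "E \<in> sets M" "prob E > 0" "prob E < e / (2 * N)"
    using non_atomic_small_subset[OF na sets.top, of "e / (2 * N)"] e N prob_space by auto
  then have NE: "N * prob E < e / 2" using N by (simp add: field_simps)
  obtain B where B: "B \<in> sets M"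
    and disj: "\<And>x i j. x \<in> space M \<Longrightarrow> i < N \<Longrightarrow> j < N \<Longrightarrow> \<tau> (- int i) x \<in> B \<Longrightarrow> \<tau> (- int j) x \<in> B \<Longrightarrow> i = j"
    and rest: "prob {x \<in> space M. \<forall>i<N. \<tau> (- int i) x \<notin> B} \<le> N * prob E"
    using rokhlin_tower[OF E(1,2) N(1)] by blast
  define R where "R = {x \<in> space M. \<forall>i<N. \<tau> (- int i) x \<notin> B}"
  have R_eq: "R = space M - (\<Union>i\<in>{..<N}. {x \<in> space M. \<tau> (- int i) x \<in> B})" by (auto simp: R_def)
  then have R: "R \<in> sets M" using \<tau>_vimage_sets[OF B] by auto
  \<comment> \<open>\<open>u i\<close> is \<open>U\<close> iterated \<open>i\<close> times, and \<open>\<nu> x\<close> is the sequence of labels met by \<open>x\<close>. Only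
    sequences that occur are used as labels of the base, so that every transition of \<open>q\<close> up a
    column is a genuine transition of \<open>p\<close>.\<close>
  define u where "u i = zpow (space M) U (int i)" for i :: nat
  have u_mp: "u i \<in> mp_automorphisms M" for i unfolding u_def by (rule zpow_mp[OF U])
  have u_Suc: "u (Suc i) x = U (u i x)" if "x \<in> space M" for i x
    using zpow_step[OF U that, of "int i"] by (simp add: u_def add.commute)
  define \<nu> where "\<nu> x = map (\<lambda>i. p (u i x)) [0..<N]" for x
  define I where "I = \<nu> ` space M"
  have I_len: "length \<alpha> = N" if "\<alpha> \<in> I" for \<alpha> using that by (auto simp: I_def \<nu>_def)
  have "I \<subseteq> {xs. set xs \<subseteq> L \<and> length xs = N}"
    using p_in mp_in_space[OF u_mp] by (auto simp: I_def \<nu>_def)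
  then have I_fin: "finite I" using finite_lists_length_eq[OF L] finite_subset by blast
  have I_ne: "I \<noteq> {}" using not_empty by (simp add: I_def)
  have nth_L: "\<alpha> ! i \<in> L" if "\<alpha> \<in> I" "i < N" for \<alpha> i
    using that p_in mp_in_space[OF u_mp] by (auto simp: I_def \<nu>_def)
  have \<nu>_sets: "{x \<in> space M. \<nu> x = \<alpha>} \<in> sets M" if a: "\<alpha> \<in> I" for \<alpha>
  proof -
    have "{x \<in> space M. \<nu> x = \<alpha>} = {x \<in> space M. \<forall>i\<in>{..<N}. p (u i x) = \<alpha> ! i}"
      using I_len[OF a] by (auto simp: \<nu>_def list_eq_iff_nth_eq)
    also have "\<dots> \<in> sets M"
      using mp_sets_pullback[OF u_mp p[OF nth_L[OF a]]] by (intro sets.sets_Collect_finite_All) auto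
    finally show ?thesis .
  qed
  have \<nu>_in: "\<nu> x \<in> I" if "x \<in> space M" for x using that by (simp add: I_def)
  have "(\<Sum>\<alpha>\<in>I. prob {x \<in> space M. \<nu> x = \<alpha>}) = 1"
    using prob_by_finite_label(2)[OF I_fin \<nu>_in \<nu>_sets, of "\<lambda>_. True"] prob_space by simp
  then have "(\<Sum>\<alpha>\<in>I. prob B * prob {x \<in> space M. \<nu> x = \<alpha>}) = prob B"
    by (simp add: sum_distrib_left[symmetric])
  then obtain d where d: "\<And>x. d x \<in> I" 
      "\<And>\<alpha>. \<alpha> \<in> I \<Longrightarrow> {x \<in> B. d x = \<alpha>} \<in> sets M"
      "\<And>\<alpha>. \<alpha> \<in> I \<Longrightarrow> prob {x \<in> B. d x = \<alpha>} = prob B * prob {x \<in> space M. \<nu> x = \<alpha>}"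
    using non_atomic_labelling[OF na I_fin I_ne B, of "\<lambda>\<alpha>. prob B * prob {x \<in> space M. \<nu> x = \<alpha>}"] by auto
  have "(\<Sum>l\<in>L. prob {x \<in> space M. p x = l}) = 1"
    using prob_by_finite_label(2)[OF L p_in p, of "\<lambda>_. True"] prob_space by simp
  then have "(\<Sum>l\<in>L. prob R * prob {x \<in> space M. p x = l}) = prob R"
    by (simp add: sum_distrib_left[symmetric])
  moreover have "L \<noteq> {}" using not_empty p_in by auto
  ultimately obtain d' where d': "\<And>x. d' x \<in> L" 
      "\<And>l. l \<in> L \<Longrightarrow> {x \<in> R. d' x = l} \<in> sets M"
      "\<And>l. l \<in> L \<Longrightarrow> prob {x \<in> R. d' x = l} = prob R * prob {x \<in> space M. p x = l}"
    using non_atomic_labelling[OF na L _ R, of "\<lambda>l. prob R * prob {x \<in> space M. p x = l}"] by auto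
  define q where "q x = (if x \<in> R then d' x 
     else d (\<tau> (- int (LEAST i. \<tau> (- int i) x \<in> B)) x) ! (LEAST i. \<tau> (- int i) x \<in> B))" for x
  have q_level: "q x = d (\<tau> (- int i) x) ! i" if x: "x \<in> space M" "i < N" "\<tau> (- int i) x \<in> B" for x i
  proof -
    have le: "(LEAST i. \<tau> (- int i) x \<in> B) \<le> i"
      by (rule Least_le[of "\<lambda>i. \<tau> (- int i) x \<in> B", OF x(3)])
    have mem: "\<tau> (- int (LEAST i. \<tau> (- int i) x \<in> B)) x \<in> B"
      by (rule LeastI[of "\<lambda>i. \<tau> (- int i) x \<in> B", OF x(3)])
    have "(LEAST i. \<tau> (- int i) x \<in> B) = i"
      by (rule disj[OF x(1) le_less_trans[OF le x(2)] x(2) mem x(3)])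
    moreover have "x \<notin> R" using x by (auto simp: R_def)
    ultimately show ?thesis by (simp add: q_def)
  qed
  have q_in: "q x \<in> L" if x: "x \<in> space M" for x
  proof (cases "x \<in> R")
    case True then show ?thesis using d'(1) by (simp add: q_def)
  next
    case False
    then obtain i where "i < N" "\<tau> (- int i) x \<in> B" using x by (auto simp: R_def)
    then show ?thesis using q_level[OF x] nth_L[OF d(1)] by simp
  qed
  have base: "{y \<in> B. d y ! i = l} \<in> sets M"
    "prob {y \<in> B. d y ! i = l} = prob B * prob {x \<in> space M. p x = l}" if "i < N" "l \<in> L" for i l
  proof -
    show "{y \<in> B. d y ! i = l} \<in> sets M"
      using prob_by_finite_label(1)[OF I_fin d(1) d(2), of "\<lambda>\<alpha>. \<alpha> ! i = l"] by simp
    have "prob {y \<in> B. d y ! i = l} = (\<Sum>\<alpha>\<in>{\<alpha>\<in>I. \<alpha> ! i = l}. prob {x \<in> B. d x = \<alpha>})"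
      using prob_by_finite_label(2)[OF I_fin d(1) d(2), of "\<lambda>\<alpha>. \<alpha> ! i = l"] by simp
    also have "\<dots> = prob B * (\<Sum>\<alpha>\<in>{\<alpha>\<in>I. \<alpha> ! i = l}. prob {x \<in> space M. \<nu> x = \<alpha>})"
      by (simp add: d(3) sum_distrib_left)
    also have "(\<Sum>\<alpha>\<in>{\<alpha>\<in>I. \<alpha> ! i = l}. prob {x \<in> space M. \<nu> x = \<alpha>}) = prob {x \<in> space M. \<nu> x ! i = l}"
      using prob_by_finite_label(2)[OF I_fin \<nu>_in \<nu>_sets, of "\<lambda>\<alpha>. \<alpha> ! i = l"] by simp
    also have "{x \<in> space M. \<nu> x ! i = l} = {x \<in> space M. p (u i x) = l}"
      using \<open>i < N\<close> by (simp add: \<nu>_def)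
    also have "prob \<dots> = prob {x \<in> space M. p x = l}"
      by (rule mp_measure_pullback[OF u_mp p[OF \<open>l \<in> L\<close>]])
    finally show "prob {y \<in> B. d y ! i = l} = prob B * prob {x \<in> space M. p x = l}" .
  qed
  have levels: "prob (\<Union>i\<in>{..<N}. {x \<in> space M. \<tau> (- int i) x \<in> F i}) = (\<Sum>i<N. prob (F i))"
    if F: "\<And>i. i < N \<Longrightarrow> F i \<in> sets M" "\<And>i. F i \<subseteq> B" for F
  proof -
    have "prob (\<Union>i\<in>{..<N}. {x \<in> space M. \<tau> (- int i) x \<in> F i}) =
        (\<Sum>i<N. prob {x \<in> space M. \<tau> (- int i) x \<in> F i})"
    proof (rule finite_measure_finite_Union)
      show "(\<lambda>i. {x \<in> space M. \<tau> (- int i) x \<in> F i}) ` {..<N} \<subseteq> sets M"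
        using \<tau>_vimage_sets[OF F(1)] by auto
      show "disjoint_family_on (\<lambda>i. {x \<in> space M. \<tau> (- int i) x \<in> F i}) {..<N}"
        unfolding disjoint_family_on_def using disj F(2) by blast
    qed simp
    then show ?thesis using \<tau>_vimage_prob F by simp
  qed
  have total: "real N * prob B + prob R = 1"
  proof -
    have "prob R = 1 - prob (\<Union>i\<in>{..<N}. {x \<in> space M. \<tau> (- int i) x \<in> B})"
      unfolding R_eq using \<tau>_vimage_sets[OF B] by (intro prob_compl) auto
    then show ?thesis using levels[of "\<lambda>_. B"] B by simp
  qed
  have q_eq: "{x \<in> space M. q x = l} =
      (\<Union>i\<in>{..<N}. {x \<in> space M. \<tau> (- int i) x \<in> {y \<in> B. d y ! i = l}}) \<union> {x \<in> R. d' x = l}"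
    (is "_ = ?T \<union> _") for l
  proof (intro equalityI subsetI)
    fix x assume "x \<in> {x \<in> space M. q x = l}"
    then have x: "x \<in> space M" "q x = l" by auto
    show "x \<in> ?T \<union> {x \<in> R. d' x = l}"
    proof (cases "x \<in> R")
      case True then show ?thesis using x by (simp add: q_def)
    next
      case False
      then obtain i where "i < N" "\<tau> (- int i) x \<in> B" using x by (auto simp: R_def)
      then show ?thesis using q_level[OF x(1)] x by auto
    qed
  next
    fix x assume "x \<in> ?T \<union> {x \<in> R. d' x = l}"
    then show "x \<in> {x \<in> space M. q x = l}"
      using q_level by (auto simp: R_def) (auto simp: q_def R_def)
  qed
  have q_sets: "{x \<in> space M. q x = l} \<in> sets M"
    and q_prob: "prob {x \<in> space M. q x = l} = prob {x \<in> space M. p x = l}" if l: "l \<in> L" for l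
  proof -
    have Ts: "(\<Union>i\<in>{..<N}. {x \<in> space M. \<tau> (- int i) x \<in> {y \<in> B. d y ! i = l}}) \<in> sets M"
      by (intro sets.finite_UN finite_lessThan \<tau>_vimage_sets base(1)[OF _ l]) simp
    then show "{x \<in> space M. q x = l} \<in> sets M" unfolding q_eq using d'(2)[OF l] by simp
    have "prob {x \<in> space M. q x = l} = (\<Sum>i<N. prob {y \<in> B. d y ! i = l}) + prob {x \<in> R. d' x = l}"
      unfolding q_eq
    proof (subst finite_measure_Union[OF Ts d'(2)[OF l]])
      show "(\<Union>i\<in>{..<N}. {x \<in> space M. \<tau> (- int i) x \<in> {y \<in> B. d y ! i = l}}) \<inter> {x \<in> R. d' x = l} = {}"
        by (auto simp: R_def)
    qed (use levels[of "\<lambda>i. {y \<in> B. d y ! i = l}"] base(1)[OF _ l] in auto)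
    also have "\<dots> = (real N * prob B + prob R) * prob {x \<in> space M. p x = l}"
      by (simp add: base(2)[OF _ l] d'(3)[OF l] algebra_simps)
    finally show "prob {x \<in> space M. q x = l} = prob {x \<in> space M. p x = l}" using total by simp
  qed
  \<comment> \<open>The transition from \<open>T\<inverse> y\<close> to \<open>y\<close> is uncontrolled only if \<open>y\<close> is on the bottom level or in
    the remainder.\<close>
  define Y where "Y = B \<union> R"
  have Y: "Y \<in> sets M" using B R by (simp add: Y_def)
  have "real N * prob B \<le> 1" using total measure_nonneg[of M R] by linarith
  then have "prob B \<le> 1 / N" using N by (simp add: field_simps)
  moreover have "prob R \<le> N * prob E" using rest by (simp add: R_def)
  ultimately have "prob B + prob R < e" using N(2) NE by linarith
  moreover have "prob Y \<le> prob B + prob R" unfolding Y_def using B R by (rule measure_Un_le)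
  ultimately have "prob Y < e" by linarith
  moreover have "\<exists>z\<in>space M. q (\<tau> (-1) y) = p z \<and> q y = p (U z)" if y: "y \<in> space M - Y" for y
  proof -
    obtain i where i: "i < N" "\<tau> (- int i) y \<in> B" using y by (auto simp: Y_def R_def)
    have "i \<noteq> 0"
    proof
      assume "i = 0"
      then show False using i(2) y by (simp add: Y_def)
    qed
    then obtain j where j: "i = Suc j" using not0_implies_Suc by blast
    have ys: "\<tau> (-1) y \<in> space M" using \<tau>_in_space y by blast
    have eq: "\<tau> (- int j) (\<tau> (-1) y) = \<tau> (- int i) y"
    proof -
      have "- int j + (-1) = - int i" by (simp add: j)
      then show ?thesis using \<tau>_add[of y "- int j" "-1"] y by simp
    qed
    obtain x where x: "x \<in> space M" "d (\<tau> (- int i) y) = \<nu> x"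
      using d(1)[of "\<tau> (- int i) y"] by (auto simp: I_def)
    have "q y = \<nu> x ! i" using q_level[of y i] y i x by simp
    then have "q y = p (U (u j x))" using i(1) u_Suc[OF x(1)] by (simp add: \<nu>_def j)
    moreover have "q (\<tau> (-1) y) = \<nu> x ! j"
      using q_level[OF ys, of j] i j eq x by simp
    then have "q (\<tau> (-1) y) = p (u j x)" using i(1) by (simp add: \<nu>_def j)
    ultimately show ?thesis using mp_in_space[OF u_mp x(1)] by blast
  qed
  ultimately show thesis using that[OF q_in q_sets q_prob Y] by blast
qed

text \<open>
  The label of \<open>x\<close> tells which sets \<open>A\<close> contain \<open>x\<close> and which contain \<open>U\<inverse> x\<close>, so the first part
  of the label of \<open>z\<close> is the second part of the label of \<open>U z\<close>. A labelling \<open>q\<close> that simulates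
  these labels along \<open>T\<close> inherits this relation outside a small set. Transporting \<open>q\<close> to \<open>p\<close> by
  \<open>W\<close> turns it into the statement that \<open>W\<inverse> T W A\<close> and \<open>U A\<close> contain the same points outside a
  small set.
\<close>

lemma conjugate_approximation:
  assumes na: "non_atomic M" and U: "U \<in> mp_automorphisms M" and e: "e > 0"
    and fin: "finite \<A>" and sets: "\<A> \<subseteq> sets M"
  shows "\<exists>W\<in>mp_automorphisms M. (\<forall>x\<in>space M. \<exists>n. W x = \<tau> n x) \<and>
     (\<forall>A\<in>\<A>. prob (sym_diff ((inv_into (space M) W \<circ> T \<circ> W) ` A) (U ` A)) < e)"
proof -
  define p where "p x = ({A \<in> \<A>. x \<in> A}, {A \<in> \<A>. inv_into (space M) U x \<in> A})" for x
  define L where "L = Pow \<A> \<times> Pow \<A>"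
  have L: "finite L" using fin by (simp add: L_def)
  have p_in: "p x \<in> L" for x by (auto simp: p_def L_def)
  have p: "{x \<in> space M. p x = l} \<in> sets M" if l: "l \<in> L" for l
  proof -
    have "{x \<in> space M. p x = l} = {x \<in> space M. {A \<in> \<A>. x \<in> A} = fst l} \<inter>
       {x \<in> space M. {A \<in> \<A>. inv_into (space M) U x \<in> A} = snd l}"
      by (auto simp: p_def)
    moreover have "fst l \<subseteq> \<A>" "snd l \<subseteq> \<A>" using l by (auto simp: L_def)
    ultimately show ?thesis
      using measurable_set_label[OF fin sets] mp_sets_pullback[OF mp_inv[OF U] measurable_set_label[OF fin sets]]
      by simp
  qed
  obtain q Y where q_in: "\<And>x. x \<in> space M \<Longrightarrow> q x \<in> L"
    and q: "\<And>l. l \<in> L \<Longrightarrow> {x \<in> space M. q x = l} \<in> sets M"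
    and qp: "\<And>l. l \<in> L \<Longrightarrow> prob {x \<in> space M. q x = l} = prob {x \<in> space M. p x = l}"
    and Y: "Y \<in> sets M" "prob Y < e"
    and good: "\<And>y. y \<in> space M - Y \<Longrightarrow> \<exists>z\<in>space M. q (\<tau> (-1) y) = p z \<and> q y = p (U z)"
    by (rule simulating_labelling[OF na U e L p_in p], assumption, rule that) blast+
  obtain W where W: "W \<in> mp_automorphisms M" "\<forall>x\<in>space M. \<exists>n. W x = \<tau> n x"
    and match: "AE x in M. q (W x) = p x"
    using matching_automorphism[OF L p_in q_in p q qp[symmetric]] by blast
  define R where "R = inv_into (space M) W \<circ> T \<circ> W"
  have R: "R \<in> mp_automorphisms M" unfolding R_def by (intro mp_comp mp_inv W T)
  \<comment> \<open>\<open>R'\<close> is the inverse of \<open>R\<close>, so membership in \<open>R ` A\<close> is read off the label of \<open>R' x\<close>.\<close>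
  define R' where "R' = inv_into (space M) W \<circ> \<tau> (-1) \<circ> W"
  have R': "R' \<in> mp_automorphisms M" unfolding R'_def by (intro mp_comp mp_inv W \<tau>_mp)
  have W_R': "W (R' x) = \<tau> (-1) (W x)" if "x \<in> space M" for x
    using mp_inv_right[OF W(1) \<tau>_in_space[OF mp_in_space[OF W(1) that]]] by (simp add: R'_def)
  have RR': "R (R' x) = x" if x: "x \<in> space M" for x
  proof -
    have "T (\<tau> (-1) (W x)) = W x"
      using \<tau>_cancel(1)[OF mp_in_space[OF W(1) x], of 1] by simp
    then show ?thesis using W_R'[OF x] mp_inv_left[OF W(1) x] by (simp add: R_def)
  qed
  have "prob (sym_diff (R ` A) (U ` A)) < e" if A: "A \<in> \<A>" for A
  proof -
    have As: "A \<in> sets M" using A sets by blast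
    note A_sub = sets.sets_into_space[OF As]
    have "AE x in M. x \<in> sym_diff (R ` A) (U ` A) \<longrightarrow> x \<in> {x \<in> space M. W x \<in> Y}"
      using match mp_AE_pullback[OF R' match] AE_space
    proof eventually_elim
      case (elim x)
      have "x \<in> R ` A \<longleftrightarrow> R' x \<in> A"
      proof
        assume "x \<in> R ` A"
        then obtain a where a: "a \<in> A" "x = R a" by blast
        then have "R (R' x) = R a" using RR'[OF elim(3)] by simp
        then have "R' x = a" using mp_inv_left[OF R] mp_in_space[OF R' elim(3)] a A_sub by (metis subsetD)
        then show "R' x \<in> A" using a by simp
      next
        assume "R' x \<in> A" then show "x \<in> R ` A" using RR'[OF elim(3)] by (metis imageI)
      qed
      then have 1: "x \<in> R ` A \<longleftrightarrow> A \<in> fst (q (\<tau> (-1) (W x)))"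
        using elim(2) W_R'[OF elim(3)] A by (simp add: p_def)
      have 2: "x \<in> U ` A \<longleftrightarrow> A \<in> snd (q (W x))"
        using mp_image_eq_vimage[OF U A_sub] elim A by (simp add: p_def)
      show ?case
      proof (intro impI)
        assume x: "x \<in> sym_diff (R ` A) (U ` A)"
        have "W x \<in> Y"
        proof (rule ccontr)
          assume "W x \<notin> Y"
          then obtain z where z: "z \<in> space M" "q (\<tau> (-1) (W x)) = p z" "q (W x) = p (U z)"
            using good[of "W x"] mp_in_space[OF W(1) elim(3)] by blast
          then have "fst (q (\<tau> (-1) (W x))) = snd (q (W x))"
            using mp_inv_left[OF U] by (simp add: p_def)
          then show False using x 1 2 by blast
        qed
        then show "x \<in> {x \<in> space M. W x \<in> Y}" using elim by simp
      qed
    qed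
    note bad = this
    have "{x \<in> space M. x \<in> Y} = Y" using sets.sets_into_space[OF Y(1)] by auto
    then have "{x \<in> space M. W x \<in> Y} \<in> sets M" "prob {x \<in> space M. W x \<in> Y} = prob Y"
      using mp_sets_pullback[OF W(1), of "\<lambda>x. x \<in> Y"] mp_measure_pullback[OF W(1), of "\<lambda>x. x \<in> Y"] Y(1)
      by simp_all
    then have "prob (sym_diff (R ` A) (U ` A)) \<le> prob Y"
      using finite_measure_mono_AE[OF bad] by simp
    then show ?thesis using Y(2) by simp
  qed
  then show ?thesis using W by (intro bexI[of _ W]) (auto simp: R_def)
qed

end

text \<open>
  Both \<open>W\<close> and its inverse map each \<open>T\<close>-orbit into itself. The \<open>R\<close>-orbit of \<open>x\<close> is the image
  under \<open>W\<inverse>\<close> of the \<open>T\<close>-orbit of \<open>W x\<close>, hence equal to the \<open>T\<close>-orbit of \<open>x\<close>.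
\<close>

lemma conjugate_orbits:
  assumes T: "T \<in> mp_automorphisms M" and W: "W \<in> mp_automorphisms M"
    and full: "\<And>x. x \<in> space M \<Longrightarrow> \<exists>n. W x = zpow (space M) T n x" and x: "x \<in> space M"
  defines "R \<equiv> inv_into (space M) W \<circ> T \<circ> W"
  shows "\<exists>n. R x = zpow (space M) T n x" and "\<exists>n. T x = zpow (space M) R n x"
proof -
  let ?\<tau> = "zpow (space M) T"
  have R: "R \<in> mp_automorphisms M" unfolding R_def by (intro mp_comp mp_inv W T)
  note Wx = mp_in_space[OF W x]
  obtain i where i: "W x = ?\<tau> i x" using full x by blast
  define z where "z = inv_into (space M) W (T (W x))"
  have z: "z \<in> space M" "W z = T (W x)"
    unfolding z_def using mp_inv_in_space[OF W] mp_inv_right[OF W] mp_in_space[OF T Wx] by auto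
  obtain j where j: "W z = ?\<tau> j z" using full z by blast
  have "z = ?\<tau> (- j) (?\<tau> 1 (?\<tau> i x))"
    using zpow_cancel(2)[OF T z(1), of j] z(2) i j by simp
  then have "z = ?\<tau> (- j + (1 + i)) x"
    using zpow_add[OF T x] by metis
  then show "\<exists>n. R x = ?\<tau> n x" by (auto simp: R_def z_def)
  have conj: "W (zpow (space M) R n x) = ?\<tau> n (W x)" for n
  proof (induction n rule: int_induct[where k = 0])
    case base then show ?case by simp
  next
    case (step1 n)
    have y: "zpow (space M) R n x \<in> space M" by (rule zpow_in_space[OF R x])
    have "W (R (zpow (space M) R n x)) = T (W (zpow (space M) R n x))"
      unfolding R_def comp_def using mp_inv_right[OF W] mp_in_space[OF T mp_in_space[OF W y]]
      by (simp add: R_def comp_def)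
    then show ?case using step1 zpow_step[OF R x] zpow_step[OF T Wx] by simp
  next
    case (step2 n)
    define y where "y = zpow (space M) R (n - 1) x"
    have y: "y \<in> space M" unfolding y_def by (rule zpow_in_space[OF R x])
    have "W (R y) = T (W y)"
      using mp_inv_right[OF W mp_in_space[OF T mp_in_space[OF W y]]] by (simp add: R_def)
    moreover have "R y = zpow (space M) R n x" using zpow_step[OF R x, of "n - 1"] by (simp add: y_def)
    ultimately have "?\<tau> n (W x) = T (W y)" using step2 by simp
    then have "?\<tau> (n - 1) (W x) = W y"
      using zpow_step_back[OF T Wx, of n] mp_inv_left[OF T mp_in_space[OF W y]] by simp
    then show ?case by (simp add: y_def)
  qed
  obtain k where k: "W (T x) = ?\<tau> k (T x)" using full mp_in_space[OF T x] by blast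
  have "W (T x) = ?\<tau> (k + 1) x" using k zpow_add[OF T x, of k 1] by simp
  moreover have "x = ?\<tau> (- i) (W x)" using zpow_cancel(2)[OF T x, of i] i by simp
  ultimately have "W (T x) = ?\<tau> (k + 1 + (- i)) (W x)" using zpow_add[OF T Wx] by metis
  then have "W (T x) = W (zpow (space M) R (k + 1 + (- i)) x)" using conj by simp
  then have "T x = zpow (space M) R (k + 1 + (- i)) x"
    using mp_inv_left[OF W] mp_in_space[OF T x] zpow_in_space[OF R x] by metis
  then show "\<exists>n. T x = zpow (space M) R n x" by blast
qed

section \<open>The group of automorphism classes and its weak topology\<close>

definition aclass :: "'x measure \<Rightarrow> ('x \<Rightarrow> 'x) \<Rightarrow> ('x \<Rightarrow> 'x) set" where
  "aclass M T = ae_equal M `` {T}"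

lemma equiv_ae_equal: "equiv (mp_automorphisms M) (ae_equal M)"
proof (rule equivI)
  show "sym (ae_equal M)" unfolding sym_def ae_equal_def by (auto simp: eq_commute)
  show "trans (ae_equal M)"
  proof (rule transI)
    fix R S T assume "(R, S) \<in> ae_equal M" "(S, T) \<in> ae_equal M"
    then have "R \<in> mp_automorphisms M" "T \<in> mp_automorphisms M"
      and 1: "AE x in M. R x = S x" and 2: "AE x in M. S x = T x"
      by (auto simp: ae_equal_def)
    moreover have "AE x in M. R x = T x" using 1 2 by eventually_elim simp
    ultimately show "(R, T) \<in> ae_equal M" by (simp add: ae_equal_def)
  qed
qed (auto simp: refl_on_def ae_equal_def)

lemma aclass_in: "T \<in> mp_automorphisms M \<Longrightarrow> aclass M T \<in> carrier (Aut M)"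
  by (simp add: Aut_def aclass_def quotientI)

lemma aclass_eq:
  assumes "S \<in> mp_automorphisms M" "T \<in> mp_automorphisms M"
  shows "aclass M S = aclass M T \<longleftrightarrow> (AE x in M. S x = T x)"
  unfolding aclass_def using eq_equiv_class_iff[OF equiv_ae_equal assms] assms
  by (auto simp: ae_equal_def)

lemma
  assumes "C \<in> carrier (Aut M)"
  shows rep_mp: "rep C \<in> mp_automorphisms M" and aclass_rep: "aclass M (rep C) = C"
proof -
  obtain T where T: "T \<in> mp_automorphisms M" "C = ae_equal M `` {T}"
    using assms by (auto simp: Aut_def elim: quotientE)
  then have "T \<in> C" using equiv_class_self[OF equiv_ae_equal] by metis
  then have "rep C \<in> C" unfolding rep_def by (rule someI[of "\<lambda>T. T \<in> C"])
  then have r: "(T, rep C) \<in> ae_equal M" using T by simp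
  then show "rep C \<in> mp_automorphisms M" by (auto simp: ae_equal_def)
  show "aclass M (rep C) = C" unfolding aclass_def T(2) 
    using equiv_class_eq[OF equiv_ae_equal r] T(2) by simp
qed

lemma rep_aclass:
  assumes "T \<in> mp_automorphisms M"
  shows "AE x in M. rep (aclass M T) x = T x"
  using aclass_eq[OF rep_mp[OF aclass_in[OF assms]] assms] aclass_rep[OF aclass_in[OF assms]] by simp

lemma aclass_mult:
  assumes S: "S \<in> mp_automorphisms M" and T: "T \<in> mp_automorphisms M"
  shows "aclass M S \<otimes>\<^bsub>Aut M\<^esub> aclass M T = aclass M (S \<circ> T)"
proof -
  have "aclass M (S' \<circ> T') = aclass M (S \<circ> T)" if "S' \<in> aclass M S" "T' \<in> aclass M T" for S' T'
  proof -
    have mp: "S' \<in> mp_automorphisms M" "T' \<in> mp_automorphisms M"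
      and ae: "AE x in M. S x = S' x" "AE x in M. T x = T' x"
      using that by (auto simp: aclass_def ae_equal_def)
    have "AE x in M. (S' \<circ> T') x = (S \<circ> T) x"
      using mp_AE_pullback[OF mp(2) ae(1)] ae(2) by eventually_elim simp
    then show ?thesis using aclass_eq mp_comp mp S T by blast
  qed
  moreover have "S \<in> aclass M S" "T \<in> aclass M T"
    unfolding aclass_def using equiv_class_self[OF equiv_ae_equal] S T by blast+
  ultimately have "(\<Union>S'\<in>aclass M S. \<Union>T'\<in>aclass M T. aclass M (S' \<circ> T')) = aclass M (S \<circ> T)"
    by blast
  then show ?thesis by (simp add: Aut_def aclass_def)
qed

lemma aclass_id: "\<one>\<^bsub>Aut M\<^esub> = aclass M id"
  by (simp add: Aut_def aclass_def)

lemma Aut_cases: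
  assumes "C \<in> carrier (Aut M)"
  obtains T where "T \<in> mp_automorphisms M" "C = aclass M T"
  using rep_mp[OF assms] aclass_rep[OF assms] by metis

lemma aclass_inv_left:
  assumes "T \<in> mp_automorphisms M"
  shows "aclass M (inv_into (space M) T) \<otimes>\<^bsub>Aut M\<^esub> aclass M T = \<one>\<^bsub>Aut M\<^esub>"
proof -
  have "AE x in M. (inv_into (space M) T \<circ> T) x = id x"
    using AE_space by eventually_elim (simp add: mp_inv_left[OF assms])
  then show ?thesis
    using aclass_eq[OF mp_comp[OF mp_inv mp_id[of M]]] assms
    by (simp add: aclass_mult mp_inv aclass_id aclass_eq mp_comp mp_id)
qed

lemma group_Aut: "group (Aut M)"
proof (rule groupI)
  show "\<one>\<^bsub>Aut M\<^esub> \<in> carrier (Aut M)" by (simp add: aclass_id aclass_in mp_id)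
  fix C assume C: "C \<in> carrier (Aut M)"
  then obtain S where S: "S \<in> mp_automorphisms M" "C = aclass M S" by (rule Aut_cases)
  show "\<one>\<^bsub>Aut M\<^esub> \<otimes>\<^bsub>Aut M\<^esub> C = C" using S by (simp add: aclass_id aclass_mult mp_id)
  show "\<exists>D\<in>carrier (Aut M). D \<otimes>\<^bsub>Aut M\<^esub> C = \<one>\<^bsub>Aut M\<^esub>"
    using S aclass_inv_left aclass_in mp_inv by blast
  fix D assume "D \<in> carrier (Aut M)"
  then obtain T where T: "T \<in> mp_automorphisms M" "D = aclass M T" by (rule Aut_cases)
  show "C \<otimes>\<^bsub>Aut M\<^esub> D \<in> carrier (Aut M)" using S T by (simp add: aclass_mult aclass_in mp_comp)
  fix E assume "E \<in> carrier (Aut M)"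
  then obtain R where R: "R \<in> mp_automorphisms M" "E = aclass M R" by (rule Aut_cases)
  show "C \<otimes>\<^bsub>Aut M\<^esub> D \<otimes>\<^bsub>Aut M\<^esub> E = C \<otimes>\<^bsub>Aut M\<^esub> (D \<otimes>\<^bsub>Aut M\<^esub> E)"
    using S T R by (simp add: aclass_mult mp_comp comp_assoc)
qed

lemma aclass_inv:
  assumes "T \<in> mp_automorphisms M"
  shows "inv\<^bsub>Aut M\<^esub> (aclass M T) = aclass M (inv_into (space M) T)"
  using group.inv_equality[OF group_Aut aclass_inv_left[OF assms]] assms by (simp add: aclass_in mp_inv)

lemma rep_mult:
  assumes "C \<in> carrier (Aut M)" "D \<in> carrier (Aut M)"
  shows "AE x in M. rep (C \<otimes>\<^bsub>Aut M\<^esub> D) x = rep C (rep D x)"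
proof -
  have "C \<otimes>\<^bsub>Aut M\<^esub> D = aclass M (rep C \<circ> rep D)"
    using aclass_mult[OF rep_mp[OF assms(1)] rep_mp[OF assms(2)]] assms by (simp add: aclass_rep)
  then show ?thesis using rep_aclass[OF mp_comp[OF rep_mp[OF assms(1)] rep_mp[OF assms(2)]]] by simp
qed

lemma rep_one: "AE x in M. rep \<one>\<^bsub>Aut M\<^esub> x = x"
  using rep_aclass[OF mp_id[of M]] by (simp add: aclass_id)

lemma rep_inv:
  assumes "C \<in> carrier (Aut M)"
  shows "AE x in M. rep (inv\<^bsub>Aut M\<^esub> C) x = inv_into (space M) (rep C) x"
  using rep_aclass[OF mp_inv[OF rep_mp[OF assms]]] aclass_inv[OF rep_mp[OF assms]] assms
  by (simp add: aclass_rep)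

text \<open>
  The pseudometrics \<open>image_dist M B\<close>, one for each measurable \<open>B\<close>, generate the weak topology.
  Each is invariant under composition from the left, and composition from the right merely
  changes \<open>B\<close>.
\<close>

definition image_dist :: "'x measure \<Rightarrow> 'x set \<Rightarrow> ('x \<Rightarrow> 'x) \<Rightarrow> ('x \<Rightarrow> 'x) \<Rightarrow> real" where
  "image_dist M B S T = measure M (sym_diff (S ` B) (T ` B))"

context prob_space
begin

lemma prob_sym_diff_triangle:
  assumes "X \<in> sets M" "Y \<in> sets M" "Z \<in> sets M"
  shows "prob (sym_diff X Z) \<le> prob (sym_diff X Y) + prob (sym_diff Y Z)"
proof -
  have "prob (sym_diff X Z) \<le> prob (sym_diff X Y \<union> sym_diff Y Z)"
    using assms by (intro finite_measure_mono) auto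
  also have "\<dots> \<le> prob (sym_diff X Y) + prob (sym_diff Y Z)"
    using assms by (intro measure_Un_le) auto
  finally show ?thesis .
qed

lemma image_dist_sym: "image_dist M B S T = image_dist M B T S"
  by (simp add: image_dist_def Un_commute)

lemma image_dist_triangle:
  assumes "R \<in> mp_automorphisms M" "S \<in> mp_automorphisms M" "T \<in> mp_automorphisms M" "B \<in> sets M"
  shows "image_dist M B R T \<le> image_dist M B R S + image_dist M B S T"
  unfolding image_dist_def using assms by (intro prob_sym_diff_triangle mp_image_sets)

lemma image_dist_AE_eq:
  assumes S: "S \<in> mp_automorphisms M" and T: "T \<in> mp_automorphisms M" and B: "B \<in> sets M"
    and eq: "AE x in M. S x = T x"
  shows "image_dist M B S T = 0"
proof -
  have "AE x in M. x \<notin> sym_diff (S ` B) (T ` B)"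
    using mp_AE_pullback[OF mp_inv[OF S] eq] AE_space
  proof eventually_elim
    case (elim x)
    then have "T (inv_into (space M) S x) = x" using mp_inv_right[OF S] by simp
    then have "inv_into (space M) T x = inv_into (space M) S x"
      using mp_inv_left[OF T mp_inv_in_space[OF S elim(2)]] by simp
    then show ?case using mp_image_eq_vimage[OF S] mp_image_eq_vimage[OF T]
      sets.sets_into_space[OF B] by auto
  qed
  moreover have "sym_diff (S ` B) (T ` B) \<in> sets M"
    using mp_image_sets[OF S B] mp_image_sets[OF T B] by auto
  ultimately show ?thesis unfolding image_dist_def using prob_eq_0 by blast
qed

lemma image_dist_cong_AE:
  assumes "S \<in> mp_automorphisms M" "T \<in> mp_automorphisms M"
    and "S' \<in> mp_automorphisms M" "T' \<in> mp_automorphisms M" and "B \<in> sets M"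
    and "AE x in M. S x = S' x" "AE x in M. T x = T' x"
  shows "image_dist M B S T = image_dist M B S' T'"
proof -
  have "image_dist M B S S' = 0" "image_dist M B T T' = 0"
    using image_dist_AE_eq assms by blast+
  then show ?thesis
    using image_dist_triangle[of S S' T B] image_dist_triangle[of S' T' T B]
      image_dist_triangle[of S' S T' B] image_dist_triangle[of S T T' B] assms
      image_dist_sym[of B S S'] image_dist_sym[of B T T'] by auto
qed

lemma image_dist_comp_left:
  assumes R: "R \<in> mp_automorphisms M" and "S \<in> mp_automorphisms M" "T \<in> mp_automorphisms M"
    and "B \<in> sets M"
  shows "image_dist M B (R \<circ> S) (R \<circ> T) = image_dist M B S T"
proof -
  have sets: "S ` B \<in> sets M" "T ` B \<in> sets M" using mp_image_sets assms by blast+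
  have inj: "inj_on R (space M)" using mp_bij[OF R] by (rule bij_betw_imp_inj_on)
  have "sym_diff (R ` S ` B) (R ` T ` B) = R ` sym_diff (S ` B) (T ` B)"
    using inj sets.sets_into_space[OF sets(1)] sets.sets_into_space[OF sets(2)]
    by (simp add: image_Un inj_on_image_set_diff[OF inj] Diff_subset subset_trans[OF Diff_subset])
  then show ?thesis
    using mp_measure_image[OF R, of "sym_diff (S ` B) (T ` B)"] sets
    by (simp add: image_dist_def image_comp)
qed

lemma image_dist_comp_right:
  "image_dist M B (S \<circ> R) (T \<circ> R) = image_dist M (R ` B) S T"
  by (simp add: image_dist_def image_comp)

lemma image_dist_comp_le:
  assumes mp: "S \<in> mp_automorphisms M" "T \<in> mp_automorphisms M"
      "S' \<in> mp_automorphisms M" "T' \<in> mp_automorphisms M" and B: "B \<in> sets M"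
  shows "image_dist M B (S \<circ> T) (S' \<circ> T') \<le> image_dist M B T T' + image_dist M (T' ` B) S S'"
  using image_dist_triangle[OF mp_comp[OF mp(1,2)] mp_comp[OF mp(1,4)] mp_comp[OF mp(3,4)] B]
  by (simp only: image_dist_comp_left[OF mp(1,2,4) B] image_dist_comp_right)

text \<open>
  By left invariance, apply \<open>S\<close> to both sides; then \<open>S \<circ> S\<inverse>\<close> and \<open>T \<circ> T\<inverse>\<close> agree.
\<close>

lemma image_dist_inv:
  assumes S: "S \<in> mp_automorphisms M" and T: "T \<in> mp_automorphisms M" and B: "B \<in> sets M"
  shows "image_dist M B (inv_into (space M) S) (inv_into (space M) T) =
    image_dist M (inv_into (space M) T ` B) S T"
proof -
  let ?S = "inv_into (space M) S" and ?T = "inv_into (space M) T"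
  have "image_dist M B ?S ?T = image_dist M B (S \<circ> ?S) (S \<circ> ?T)"
    using image_dist_comp_left[OF S mp_inv[OF S] mp_inv[OF T] B] by simp
  also have "\<dots> = image_dist M B (T \<circ> ?T) (S \<circ> ?T)"
  proof (rule image_dist_cong_AE)
    show "AE x in M. (S \<circ> ?S) x = (T \<circ> ?T) x"
      using AE_space by eventually_elim (simp add: mp_inv_right[OF S] mp_inv_right[OF T])
  qed (intro mp_comp mp_inv S T B AE_I2 refl)+
  also have "\<dots> = image_dist M (?T ` B) S T"
    by (simp only: image_dist_comp_right image_dist_sym)
  finally show ?thesis .
qed

text \<open>
  This transfers closeness from a dense sequence of sets to all measurable sets.
\<close>

lemma image_dist_change_set:
  assumes S: "S \<in> mp_automorphisms M" and T: "T \<in> mp_automorphisms M"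
    and A: "A \<in> sets M" and B: "B \<in> sets M"
  shows "image_dist M B S T \<le> image_dist M A S T + 2 * prob (sym_diff A B)"
proof -
  have move: "prob (sym_diff (R ` A) (R ` B)) = prob (sym_diff A B)" if R: "R \<in> mp_automorphisms M" for R
  proof -
    have inj: "inj_on R (space M)" using mp_bij[OF R] by (rule bij_betw_imp_inj_on)
    have "sym_diff (R ` A) (R ` B) = R ` sym_diff A B"
      using sets.sets_into_space[OF A] sets.sets_into_space[OF B]
      by (simp add: image_Un inj_on_image_set_diff[OF inj] subset_trans[OF Diff_subset])
    then show ?thesis using mp_measure_image[OF R, of "sym_diff A B"] A B by simp
  qed
  note meas = mp_image_sets[OF S A] mp_image_sets[OF S B] mp_image_sets[OF T A] mp_image_sets[OF T B]
  have "prob (sym_diff (S ` B) (T ` B)) \<le>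
      prob (sym_diff (S ` B) (S ` A)) + prob (sym_diff (S ` A) (T ` B))"
    using prob_sym_diff_triangle meas by blast
  also have "prob (sym_diff (S ` A) (T ` B)) \<le>
      prob (sym_diff (S ` A) (T ` A)) + prob (sym_diff (T ` A) (T ` B))"
    using prob_sym_diff_triangle meas by blast
  finally show ?thesis using move[OF S] move[OF T] by (simp add: image_dist_def Un_commute)
qed

lemma standard_borel_separating_sets:
  assumes "standard_borel_space M"
  obtains \<B> where "countable \<B>" "\<B> \<subseteq> sets M"
    "\<And>x y. x \<in> space M \<Longrightarrow> y \<in> space M \<Longrightarrow> (\<And>B. B \<in> \<B> \<Longrightarrow> x \<in> B \<longleftrightarrow> y \<in> B) \<Longrightarrow> x = y"
proof -
  obtain X where X: "topspace X = space M" "completely_metrizable_space X" "second_countable X"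
    "sets M = sigma_sets (space M) {U. openin X U}"
    using assms by (auto simp: standard_borel_space_def)
  obtain \<B> where \<B>: "countable \<B>" "\<And>V. V \<in> \<B> \<Longrightarrow> openin X V"
    "\<And>U x. openin X U \<Longrightarrow> x \<in> U \<Longrightarrow> \<exists>V\<in>\<B>. x \<in> V \<and> V \<subseteq> U"
    using X(3) unfolding second_countable_def by auto
  have t1: "t1_space X"
    using X(2) completely_metrizable_imp_metrizable_space metrizable_imp_t1_space by blast
  have "\<B> \<subseteq> sets M" using \<B>(2) X(4) by auto
  moreover have "x = y" if xy: "x \<in> space M" "y \<in> space M" "\<And>B. B \<in> \<B> \<Longrightarrow> x \<in> B \<longleftrightarrow> y \<in> B" for x y
  proof (rule ccontr)
    assume "x \<noteq> y"
    then obtain U where U: "openin X U" "x \<in> U" "y \<notin> U"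
      using t1 xy(1,2) X(1) unfolding t1_space_def by metis
    then obtain V where "V \<in> \<B>" "x \<in> V" "V \<subseteq> U" using \<B>(3) by blast
    then show False using xy(3)[of V] U(3) by blast
  qed
  ultimately show thesis using that \<B>(1) by blast
qed

text \<open>
  An automorphism is determined almost everywhere by its action on sets: if \<open>S\<close> and \<open>T\<close> move
  each set of a countable separating family in the same way up to null sets, then almost surely
  no set of the family distinguishes \<open>S\<inverse> x\<close> from \<open>T\<inverse> x\<close>. This is where the space has to be
  standard.
\<close>

lemma image_dist_separates:
  assumes sb: "standard_borel_space M"
    and S: "S \<in> mp_automorphisms M" and T: "T \<in> mp_automorphisms M"
    and zero: "\<And>B. B \<in> sets M \<Longrightarrow> image_dist M B S T = 0"
  shows "AE x in M. S x = T x"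
proof -
  obtain \<B> where \<B>: "countable \<B>" "\<B> \<subseteq> sets M"
    "\<And>x y. x \<in> space M \<Longrightarrow> y \<in> space M \<Longrightarrow> (\<And>B. B \<in> \<B> \<Longrightarrow> x \<in> B \<longleftrightarrow> y \<in> B) \<Longrightarrow> x = y"
    using standard_borel_separating_sets[OF sb] by blast
  let ?S = "inv_into (space M) S" and ?T = "inv_into (space M) T"
  have "AE x in M. ?S x \<in> B \<longleftrightarrow> ?T x \<in> B" if B: "B \<in> \<B>" for B
  proof -
    have Bs: "B \<in> sets M" using B \<B>(2) by blast
    then have "sym_diff (S ` B) (T ` B) \<in> sets M"
      using mp_image_sets[OF S] mp_image_sets[OF T] by auto
    then have "AE x in M. x \<notin> sym_diff (S ` B) (T ` B)"
      using zero[OF Bs] prob_eq_0 by (simp add: image_dist_def)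
    then show ?thesis using AE_space
    proof eventually_elim
      case (elim x)
      then show ?case
        using mp_image_eq_vimage[OF S sets.sets_into_space[OF Bs]]
          mp_image_eq_vimage[OF T sets.sets_into_space[OF Bs]] by auto
    qed
  qed
  then have "AE x in M. \<forall>B\<in>\<B>. ?S x \<in> B \<longleftrightarrow> ?T x \<in> B"
    by (simp add: AE_ball_countable[OF \<B>(1)])
  then have "AE x in M. ?S x = ?T x"
    using AE_space
  proof eventually_elim
    case (elim x)
    show ?case
      by (rule \<B>(3)[OF mp_inv_in_space[OF S elim(2)] mp_inv_in_space[OF T elim(2)]])
        (use elim(1) in blast)
  qed
  from mp_AE_pullback[OF S this] show ?thesis
    using AE_space
  proof eventually_elim
    case (elim x)
    then have "x = ?T (S x)" using mp_inv_left[OF S] by simp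
    then show ?case using mp_inv_right[OF T mp_in_space[OF S elim(2)]] by simp
  qed
qed

lemma weak_dist_summable:
  "summable (\<lambda>i. (1/2) ^ Suc i * image_dist M (A i) S T)"
proof (rule summable_comparison_test')
  show "summable (\<lambda>i. (1/2::real) ^ Suc i)" by (simp add: summable_geometric)
  show "norm ((1/2) ^ Suc i * image_dist M (A i) S T) \<le> (1/2) ^ Suc i" for i
    unfolding image_dist_def by (simp add: mult_left_le)
qed

lemma weak_dist_eq:
  "weak_dist M A C D = (\<Sum>i. (1/2) ^ Suc i * image_dist M (A i) (rep C) (rep D))"
  by (simp add: weak_dist_def image_dist_def)

lemma image_dist_nonneg [simp]: "0 \<le> image_dist M B S T"
  by (simp add: image_dist_def)

lemma weak_dist_zero_imp_eq:
  assumes sb: "standard_borel_space M" and A: "dense_sequence M A"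
    and C: "C \<in> carrier (Aut M)" and D: "D \<in> carrier (Aut M)" and zero: "weak_dist M A C D = 0"
  shows "C = D"
proof -
  let ?S = "rep C" and ?T = "rep D"
  note mp = rep_mp[OF C] rep_mp[OF D]
  have "\<forall>i. (1/2) ^ Suc i * image_dist M (A i) ?S ?T = 0"
    using zero suminf_eq_zero_iff[OF weak_dist_summable[of A ?S ?T]] by (simp add: weak_dist_eq)
  then have zero_A: "image_dist M (A i) ?S ?T = 0" for i by simp
  have "image_dist M B ?S ?T = 0" if B: "B \<in> sets M" for B
  proof (rule ccontr)
    assume "image_dist M B ?S ?T \<noteq> 0"
    then have "image_dist M B ?S ?T / 2 > 0" using image_dist_nonneg[of B ?S ?T] by linarith
    then obtain i where "prob (sym_diff (A i) B) < image_dist M B ?S ?T / 2"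
      using A B unfolding dense_sequence_def by blast
    moreover have "A i \<in> sets M" using A by (auto simp: dense_sequence_def)
    ultimately show False
      using image_dist_change_set[OF mp _ B, of "A i"] zero_A[of i] by simp
  qed
  then have "AE x in M. ?S x = ?T x" by (rule image_dist_separates[OF sb mp])
  then show ?thesis using aclass_eq[OF mp] aclass_rep C D by metis
qed

lemma weak_dist_metric:
  assumes sb: "standard_borel_space M" and A: "dense_sequence M A"
  shows "Metric_space (carrier (Aut M)) (weak_dist M A)"
proof
  fix C D
  show "0 \<le> weak_dist M A C D"
    unfolding weak_dist_eq by (intro suminf_nonneg weak_dist_summable) simp
  show "weak_dist M A C D = weak_dist M A D C"
    unfolding weak_dist_eq by (simp only: image_dist_sym[of _ "rep C"])
  assume C: "C \<in> carrier (Aut M)" and D: "D \<in> carrier (Aut M)"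
  show "weak_dist M A C D = 0 \<longleftrightarrow> C = D"
    using weak_dist_zero_imp_eq[OF sb A C D] by (auto simp: weak_dist_def)
  fix E assume E: "E \<in> carrier (Aut M)"
  have As: "A i \<in> sets M" for i using A by (auto simp: dense_sequence_def)
  have "weak_dist M A C E \<le>
    (\<Sum>i. (1/2) ^ Suc i * image_dist M (A i) (rep C) (rep D) + (1/2) ^ Suc i * image_dist M (A i) (rep D) (rep E))"
    unfolding weak_dist_eq
  proof (rule suminf_le)
    fix i
    show "(1/2) ^ Suc i * image_dist M (A i) (rep C) (rep E) \<le>
       (1/2) ^ Suc i * image_dist M (A i) (rep C) (rep D) + (1/2) ^ Suc i * image_dist M (A i) (rep D) (rep E)"
      using image_dist_triangle[OF rep_mp[OF C] rep_mp[OF D] rep_mp[OF E] As[of i]]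
      by (simp add: distrib_left[symmetric])
  qed (intro weak_dist_summable summable_add)+
  also have "\<dots> = weak_dist M A C D + weak_dist M A D E"
    unfolding weak_dist_eq by (rule suminf_add[symmetric]; rule weak_dist_summable)
  finally show "weak_dist M A C E \<le> weak_dist M A C D + weak_dist M A D E" .
qed

text \<open>
  The tail of the series defining \<open>weak_dist\<close> is uniformly small.
\<close>

lemma weak_ball_contains_image_dist_ball:
  assumes r: "r > 0"
  obtains K \<delta> where "\<delta> > 0"
    "\<And>C D. (\<And>i. i < K \<Longrightarrow> image_dist M (A i) (rep C) (rep D) < \<delta>) \<Longrightarrow> weak_dist M A C D < r"
proof -
  obtain K :: nat where K: "(1/2::real) ^ K < r / 2" using real_arch_pow_inv[of "r/2" "1/2"] r by auto
  have "weak_dist M A C D < r"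
    if close: "\<And>i. i < K \<Longrightarrow> image_dist M (A i) (rep C) (rep D) < r / 2" for C D
  proof -
    let ?f = "\<lambda>i. (1/2::real) ^ Suc i * image_dist M (A i) (rep C) (rep D)"
    have sums: "(\<lambda>i. (1/2::real) ^ Suc i) sums 1" by (rule power_half_series)
    have "(\<Sum>i<K. ?f i) \<le> (\<Sum>i<K. (1/2) ^ Suc i * (r / 2))"
      using close by (intro sum_mono mult_left_mono) (auto intro: less_imp_le)
    also have "\<dots> = (\<Sum>i<K. (1/2) ^ Suc i) * (r / 2)" by (rule sum_distrib_right[symmetric])
    also have "\<dots> \<le> 1 * (r / 2)"
      using r sum_le_suminf[OF sums_summable[OF sums], of "{..<K}"] sums_unique[OF sums]
      by (intro mult_right_mono) auto
    finally have head: "(\<Sum>i<K. ?f i) \<le> r / 2" by simp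
    have "(\<Sum>i. ?f (i + K)) \<le> (\<Sum>i. (1/2) ^ K * (1/2) ^ Suc i)"
    proof (rule suminf_le)
      show "?f (i + K) \<le> (1/2) ^ K * (1/2) ^ Suc i" for i
        by (simp add: image_dist_def power_add mult_left_le)
      show "summable (\<lambda>i. ?f (i + K))" by (rule summable_ignore_initial_segment[OF weak_dist_summable])
      show "summable (\<lambda>i. (1/2::real) ^ K * (1/2) ^ Suc i)"
        by (rule summable_mult[OF sums_summable[OF sums]])
    qed
    also have "\<dots> = (1/2) ^ K"
      using suminf_mult[OF sums_summable[OF sums], of "(1/2) ^ K"] sums_unique[OF sums] by simp
    finally have tail: "(\<Sum>i. ?f (i + K)) < r / 2" using K by linarith
    have "weak_dist M A C D = (\<Sum>i. ?f (i + K)) + (\<Sum>i<K. ?f i)"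
      unfolding weak_dist_eq by (rule suminf_split_initial_segment[OF weak_dist_summable])
    then show ?thesis using head tail by linarith
  qed
  then show thesis using that[of "r / 2" K] r by auto
qed

end

section \<open>Homomorphisms out of free groups\<close>

lemma word_value_Nil [simp]: "word_value G [] = \<one>\<^bsub>G\<^esub>"
  by (simp add: word_value_def)

lemma word_value_Cons [simp]:
  "word_value G ((s, i) # w) = (if i then s else inv\<^bsub>G\<^esub> s) \<otimes>\<^bsub>G\<^esub> word_value G w"
  by (simp add: word_value_def)

context group
begin

lemma word_value_closed: "S \<subseteq> carrier G \<Longrightarrow> w \<in> lists (S \<times> UNIV) \<Longrightarrow> word_value G w \<in> carrier G"
  by (induction w) auto

lemma word_value_append:
  assumes "S \<subseteq> carrier G" "u \<in> lists (S \<times> UNIV)" "v \<in> lists (S \<times> UNIV)"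
  shows "word_value G (u @ v) = word_value G u \<otimes> word_value G v"
  using assms(2)
proof (induction u)
  case Nil then show ?case using word_value_closed assms by simp
next
  case (Cons x u)
  obtain s i where x: "x = (s, i)" by (cases x)
  then have "s \<in> carrier G" using Cons assms(1) by auto
  then show ?case using Cons word_value_closed[OF assms(1)] assms(3) by (auto simp: x m_assoc)
qed

lemma finitely_generated_countable:
  assumes "finitely_generated G"
  shows "countable (carrier G)"
proof -
  obtain F where F: "finite F" "F \<subseteq> carrier G" "generate G F = carrier G"
    using assms by (auto simp: finitely_generated_def)
  have "g \<in> word_value G ` lists (F \<times> UNIV)" if "g \<in> generate G F" for g
    using that
  proof (induction rule: generate.induct)
    case one
    have "word_value G [] = \<one>" by simp
    then show ?case by (metis imageI lists.Nil)
  next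
    case (incl h)
    then have "word_value G [(h, True)] = h" using F(2) by auto
    then show ?case using incl by (intro image_eqI[of _ _ "[(h, True)]"]) auto
  next
    case (inv h)
    then have "word_value G [(h, False)] = inv h" using F(2) by auto
    then show ?case using inv by (intro image_eqI[of _ _ "[(h, False)]"]) auto
  next
    case (eng g h)
    then obtain u v where uv: "u \<in> lists (F \<times> UNIV)" "v \<in> lists (F \<times> UNIV)"
      "g = word_value G u" "h = word_value G v" by blast
    then have "g \<otimes> h = word_value G (u @ v)" using word_value_append[OF F(2)] by simp
    then show ?case using uv by (intro image_eqI[of _ _ "u @ v"]) auto
  qed
  then have "carrier G \<subseteq> word_value G ` lists (F \<times> UNIV)" using F(3) by auto
  moreover have "countable (lists (F \<times> (UNIV :: bool set)))"
    using F(1) by (intro countable_lists countable_finite) simp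
  ultimately show ?thesis by (rule countable_subset[OF _ countable_image])
qed

text \<open>
  The premises about \<open>gen\<close> and \<open>inv_gen\<close> follow the letters of a word from the right, in the
  order in which \<open>word_value\<close> multiplies them.
\<close>

lemma free_generating_set_induct [consumes 2, case_names one gen inv_gen]:
  assumes free: "free_generating_set G S" and g: "g \<in> carrier G"
    and one: "P \<one>"
    and gen: "\<And>s g. s \<in> S \<Longrightarrow> g \<in> carrier G \<Longrightarrow> P g \<Longrightarrow> P (s \<otimes> g)"
    and inv_gen: "\<And>s g. s \<in> S \<Longrightarrow> g \<in> carrier G \<Longrightarrow> P g \<Longrightarrow> P (inv s \<otimes> g)"
  shows "P g"
proof -
  have S: "S \<subseteq> carrier G" and "carrier G = word_value G ` reduced_words S"
    using free by (auto simp: free_generating_set_def bij_betw_def)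
  then obtain w where w: "w \<in> lists (S \<times> UNIV)" "g = word_value G w"
    using g by (auto simp: reduced_words_def)
  have "P (word_value G w)" using w(1)
  proof (induction w)
    case Nil then show ?case using one by simp
  next
    case (Cons x w)
    obtain s i where x: "x = (s, i)" by (cases x)
    show ?case using gen[of s "word_value G w"] inv_gen[of s "word_value G w"] Cons
      word_value_closed[OF S] by (auto simp: x)
  qed
  then show ?thesis using w(2) by simp
qed

end

text \<open>
  Reducing a word changes neither its value in \<open>G\<close> nor the value of its image in \<open>H\<close>, since both
  are groups. The two values must be preserved by the same reduced word: this is what makes the
  map defined on reduced words by substituting \<open>f\<close> multiplicative.
\<close>

lemma word_reduction:
  assumes G: "group G" and H: "group H" and S: "S \<subseteq> carrier G" and f: "f ` S \<subseteq> carrier H"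
    and w: "w \<in> lists (S \<times> UNIV)"
  shows "\<exists>w'\<in>reduced_words S. word_value G w' = word_value G w \<and>
     word_value H (map (apfst f) w') = word_value H (map (apfst f) w)"
  using w
proof (induction w)
  case Nil
  then show ?case by (intro bexI[of _ "[]"]) (auto simp: reduced_words_def)
next
  case (Cons x w)
  obtain s i where x: "x = (s, i)" by (cases x)
  have s: "s \<in> S" using Cons x by auto
  obtain w' where w': "w' \<in> reduced_words S" "word_value G w' = word_value G w"
    "word_value H (map (apfst f) w') = word_value H (map (apfst f) w)" using Cons by blast
  show ?case
  proof (cases "\<exists>w2. w' = (s, \<not> i) # w2")
    case True
    then obtain w2 where w2: "w' = (s, \<not> i) # w2" by blast
    have red: "w2 \<in> reduced_words S"
      using w'(1) by (auto simp: reduced_words_def w2 successively_Cons)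
    then have lists: "w2 \<in> lists (S \<times> UNIV)" by (simp add: reduced_words_def)
    have mapl: "map (apfst f) w2 \<in> lists (f ` S \<times> UNIV)" using lists by (induction w2) auto
    have inverse_letters: "(if i then s else inv\<^bsub>K\<^esub> s) \<otimes>\<^bsub>K\<^esub> ((if \<not> i then s else inv\<^bsub>K\<^esub> s) \<otimes>\<^bsub>K\<^esub> v) = v"
      if K: "group K" "s \<in> carrier K" "v \<in> carrier K" for K :: "('z, 'y) monoid_scheme" and s v
      using K group.r_inv[OF K(1)] group.l_inv[OF K(1)]
      by (simp add: monoid.m_assoc[symmetric] group.is_monoid)
    have "word_value G w2 = word_value G (x # w)"
      using inverse_letters[OF G _ group.word_value_closed[OF G S lists], of s] s S w'(2)
      by (auto simp: x w2)
    moreover have "word_value H (map (apfst f) w2) = word_value H (map (apfst f) (x # w))"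
    proof -
      have "f s \<in> carrier H" using s f by blast
      then show ?thesis
        using inverse_letters[OF H _ group.word_value_closed[OF H f mapl], of "f s"] w'(3)[symmetric]
        by (auto simp: x w2)
    qed
    ultimately show ?thesis using red by (intro bexI[of _ w2]) auto
  next
    case False
    have "x # w' \<in> reduced_words S"
      using w'(1) False s x by (cases w') (auto simp: reduced_words_def)
    then show ?thesis using w' by (intro bexI[of _ "x # w'"]) (auto simp: x)
  qed
qed

lemma free_extension:
  assumes G: "group G" and H: "group H" and free: "free_generating_set G S" and f: "f ` S \<subseteq> carrier H"
  obtains h where "h \<in> hom G H" "\<And>s. s \<in> S \<Longrightarrow> h s = f s"
proof -
  have S: "S \<subseteq> carrier G" and bij: "bij_betw (word_value G) (reduced_words S) (carrier G)"
    using free by (auto simp: free_generating_set_def)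
  define r where "r = inv_into (reduced_words S) (word_value G)"
  define h where "h g = word_value H (map (apfst f) (r g))" for g
  have r: "r g \<in> reduced_words S" "word_value G (r g) = g" if "g \<in> carrier G" for g
    using that bij unfolding r_def
    by (auto simp: bij_betw_def f_inv_into_f intro: inv_into_into)
  have r_val: "r (word_value G w) = w" if "w \<in> reduced_words S" for w
    unfolding r_def using bij_betw_inv_into_left[OF bij that] .
  have red_lists: "reduced_words S \<subseteq> lists (S \<times> UNIV)" by (auto simp: reduced_words_def)
  have map_lists: "map (apfst f) w \<in> lists (f ` S \<times> UNIV)" if "w \<in> lists (S \<times> UNIV)" for w
    using that by (induction w) auto
  have "h \<in> hom G H"
  proof (rule homI)
    fix g assume g: "g \<in> carrier G"
    show "h g \<in> carrier H" unfolding h_def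
      using group.word_value_closed[OF H f map_lists] r(1)[OF g] red_lists by blast
    fix k assume k: "k \<in> carrier G"
    have gk: "r g \<in> lists (S \<times> UNIV)" "r k \<in> lists (S \<times> UNIV)" using r(1) g k red_lists by auto
    then obtain w where w: "w \<in> reduced_words S" "word_value G w = word_value G (r g @ r k)"
      "word_value H (map (apfst f) w) = word_value H (map (apfst f) (r g @ r k))"
      using word_reduction[OF G H S f, of "r g @ r k"] by auto
    have "word_value G w = g \<otimes>\<^bsub>G\<^esub> k"
      unfolding w(2) group.word_value_append[OF G S gk] using r(2) g k by simp
    then have "r (g \<otimes>\<^bsub>G\<^esub> k) = w" using r_val[OF w(1)] by simp
    then have "h (g \<otimes>\<^bsub>G\<^esub> k) = word_value H (map (apfst f) (r g) @ map (apfst f) (r k))"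
      using w(3) by (simp add: h_def)
    also have "\<dots> = h g \<otimes>\<^bsub>H\<^esub> h k"
      unfolding h_def by (rule group.word_value_append[OF H f map_lists map_lists]) (rule gk)+
    finally show "h (g \<otimes>\<^bsub>G\<^esub> k) = h g \<otimes>\<^bsub>H\<^esub> h k" .
  qed
  moreover have "h s = f s" if s: "s \<in> S" for s
  proof -
    have "[(s, True)] \<in> reduced_words S" using s by (simp add: reduced_words_def)
    moreover have "word_value G [(s, True)] = s"
      using s S group.is_monoid[OF G] monoid.r_one by fastforce
    ultimately have "r s = [(s, True)]" using r_val by fastforce
    then show ?thesis using s f group.is_monoid[OF H] monoid.r_one by (fastforce simp: h_def)
  qed
  ultimately show thesis by (rule that)
qed

section \<open>Closeness on generators\<close>

text \<open>
  \<open>P\<close> holds for all homomorphisms sufficiently close to \<open>b\<close> on the generators. The tolerance is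
  uniform in \<open>s \<in> S\<close>, and the sets \<open>A\<close> on which closeness is tested are finitely many; this is
  the form in which each generator can be approximated separately.
\<close>

definition holds_near ::
    "('g, 'b) monoid_scheme \<Rightarrow> 'x measure \<Rightarrow> 'g set \<Rightarrow> ('g \<Rightarrow> ('x \<Rightarrow> 'x) set) \<Rightarrow>
       (('g \<Rightarrow> ('x \<Rightarrow> 'x) set) \<Rightarrow> bool) \<Rightarrow> bool" where
  "holds_near G M S b P \<longleftrightarrow>
     (\<exists>\<A> \<delta>. finite \<A> \<and> \<A> \<subseteq> sets M \<and> \<delta> > 0 \<and>
        (\<forall>c\<in>hom G (Aut M). (\<forall>s\<in>S. \<forall>A\<in>\<A>. image_dist M A (rep (c s)) (rep (b s)) < \<delta>) \<longrightarrow> P c))"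

lemma holds_near_mono:
  assumes "holds_near G M S b P" "\<And>c. c \<in> hom G (Aut M) \<Longrightarrow> P c \<Longrightarrow> Q c"
  shows "holds_near G M S b Q"
  using assms unfolding holds_near_def by meson

lemma holds_near_generators:
  assumes "A \<in> sets M" "e > 0"
  shows "holds_near G M S b (\<lambda>c. \<forall>s\<in>S. image_dist M A (rep (c s)) (rep (b s)) < e)"
  unfolding holds_near_def using assms by (intro exI[of _ "{A}"] exI[of _ e]) auto

lemma holds_near_True: "holds_near G M S b (\<lambda>_. True)"
  unfolding holds_near_def by (intro exI[of _ "{}"] exI[of _ 1]) auto

lemma holds_near_conj:
  assumes "holds_near G M S b P" "holds_near G M S b Q"
  shows "holds_near G M S b (\<lambda>c. P c \<and> Q c)"
proof -
  obtain \<A> \<delta> where 1: "finite \<A>" "\<A> \<subseteq> sets M" "\<delta> > 0"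
    "\<And>c. c \<in> hom G (Aut M) \<Longrightarrow> (\<forall>s\<in>S. \<forall>A\<in>\<A>. image_dist M A (rep (c s)) (rep (b s)) < \<delta>) \<Longrightarrow> P c"
    using assms(1) unfolding holds_near_def by blast
  obtain \<B> \<epsilon> where 2: "finite \<B>" "\<B> \<subseteq> sets M" "\<epsilon> > 0"
    "\<And>c. c \<in> hom G (Aut M) \<Longrightarrow> (\<forall>s\<in>S. \<forall>A\<in>\<B>. image_dist M A (rep (c s)) (rep (b s)) < \<epsilon>) \<Longrightarrow> Q c"
    using assms(2) unfolding holds_near_def by blast
  show ?thesis unfolding holds_near_def
  proof (intro exI[of _ "\<A> \<union> \<B>"] exI[of _ "min \<delta> \<epsilon>"] conjI ballI impI)
    fix c assume c: "c \<in> hom G (Aut M)"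
      "\<forall>s\<in>S. \<forall>A\<in>\<A> \<union> \<B>. image_dist M A (rep (c s)) (rep (b s)) < min \<delta> \<epsilon>"
    show "P c" by (rule 1(4)[OF c(1)]) (use c(2) in auto)
    show "Q c" by (rule 2(4)[OF c(1)]) (use c(2) in auto)
  qed (use 1 2 in auto)
qed

lemma holds_near_finite_ball:
  assumes "finite J" "\<And>j. j \<in> J \<Longrightarrow> holds_near G M S b (P j)"
  shows "holds_near G M S b (\<lambda>c. \<forall>j\<in>J. P j c)"
  using assms
proof (induction J rule: finite_induct)
  case empty then show ?case using holds_near_True by simp
next
  case (insert j J)
  then have "holds_near G M S b (\<lambda>c. P j c \<and> (\<forall>j\<in>J. P j c))" by (intro holds_near_conj) auto
  then show ?case by simp
qed

context prob_space
begin

text \<open>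
  Closeness on the generators implies closeness at every group element, by induction along a
  word: for a product, the error is the sum of the errors of the factors, where the left factor
  is tested on an image of the original set under \<open>b\<close>; for the inverse of a generator, the test
  set is moved by \<open>image_dist_inv\<close>.
\<close>

lemma holds_near_image_dist:
  assumes G: "group G" and free: "free_generating_set G S" and b: "b \<in> hom G (Aut M)"
    and g: "g \<in> carrier G" and B: "B \<in> sets M" and e: "e > 0"
  shows "holds_near G M S b (\<lambda>c. image_dist M B (rep (c g)) (rep (b g)) < e)"
  using free g B e
proof (induction arbitrary: B e rule: group.free_generating_set_induct[OF G, consumes 2, case_names one gen inv_gen])
  case one
  have "c \<one>\<^bsub>G\<^esub> = b \<one>\<^bsub>G\<^esub>" if "c \<in> hom G (Aut M)" for c
    using hom_one[OF that G group_Aut] hom_one[OF b G group_Aut] by simp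
  then show ?case
    using one by (intro holds_near_mono[OF holds_near_True]) (simp add: image_dist_def)
next
  case (gen s g)
  have S: "S \<subseteq> carrier G" using free by (simp add: free_generating_set_def)
  have s: "s \<in> carrier G" using gen S by blast
  define B' where "B' = rep (b g) ` B"
  have B': "B' \<in> sets M"
    unfolding B'_def by (rule mp_image_sets[OF rep_mp[OF hom_in_carrier[OF b gen(2)]] gen(4)])
  have "holds_near G M S b (\<lambda>c. image_dist M B (rep (c g)) (rep (b g)) < e / 2 \<and>
      (\<forall>s\<in>S. image_dist M B' (rep (c s)) (rep (b s)) < e / 2))"
    using gen B' by (intro holds_near_conj gen.IH holds_near_generators) auto
  then show ?case
  proof (rule holds_near_mono)
    fix c assume c: "c \<in> hom G (Aut M)"
      and near: "image_dist M B (rep (c g)) (rep (b g)) < e / 2 \<and>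
        (\<forall>s\<in>S. image_dist M B' (rep (c s)) (rep (b s)) < e / 2)"
    have prod: "AE x in M. rep (d (s \<otimes>\<^bsub>G\<^esub> g)) x = (rep (d s) \<circ> rep (d g)) x"
      if d: "d \<in> hom G (Aut M)" for d
      using rep_mult[OF hom_in_carrier[OF d s] hom_in_carrier[OF d gen(2)]] hom_mult[OF d s gen(2)]
      by simp
    have mp: "rep (d k) \<in> mp_automorphisms M" if "d \<in> hom G (Aut M)" "k \<in> carrier G" for d k
      by (rule rep_mp[OF hom_in_carrier[OF that]])
    have sg: "s \<otimes>\<^bsub>G\<^esub> g \<in> carrier G"
      using G s gen(2) by (simp add: group.is_monoid monoid.m_closed)
    have "image_dist M B (rep (c (s \<otimes>\<^bsub>G\<^esub> g))) (rep (b (s \<otimes>\<^bsub>G\<^esub> g))) =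
      image_dist M B (rep (c s) \<circ> rep (c g)) (rep (b s) \<circ> rep (b g))"
      by (rule image_dist_cong_AE) (intro mp mp_comp prod b c s sg gen)+
    also have "\<dots> \<le> image_dist M B (rep (c g)) (rep (b g)) + image_dist M B' (rep (c s)) (rep (b s))"
      unfolding B'_def by (intro image_dist_comp_le mp b c s gen)
    also have "\<dots> < e" using near gen(1) by fastforce
    finally show "image_dist M B (rep (c (s \<otimes>\<^bsub>G\<^esub> g))) (rep (b (s \<otimes>\<^bsub>G\<^esub> g))) < e" .
  qed
next
  case (inv_gen s g)
  have S: "S \<subseteq> carrier G" using free by (simp add: free_generating_set_def)
  have s: "s \<in> carrier G" using inv_gen S by blast
  have invs: "inv\<^bsub>G\<^esub> s \<in> carrier G" by (rule group.inv_closed[OF G s])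
  let ?I = "inv_into (space M)"
  have mp: "rep (d k) \<in> mp_automorphisms M" if "d \<in> hom G (Aut M)" "k \<in> carrier G" for d k
    by (rule rep_mp[OF hom_in_carrier[OF that]])
  define B' where "B' = ?I (rep (b s)) ` rep (b g) ` B"
  have B': "B' \<in> sets M"
    unfolding B'_def by (intro mp_image_sets mp_inv mp b s inv_gen)
  have "holds_near G M S b (\<lambda>c. image_dist M B (rep (c g)) (rep (b g)) < e / 2 \<and>
      (\<forall>s\<in>S. image_dist M B' (rep (c s)) (rep (b s)) < e / 2))"
    using inv_gen B' by (intro holds_near_conj inv_gen.IH holds_near_generators) auto
  then show ?case
  proof (rule holds_near_mono)
    fix c assume c: "c \<in> hom G (Aut M)"
      and near: "image_dist M B (rep (c g)) (rep (b g)) < e / 2 \<and>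
        (\<forall>s\<in>S. image_dist M B' (rep (c s)) (rep (b s)) < e / 2)"
    have prod: "AE x in M. rep (d (inv\<^bsub>G\<^esub> s \<otimes>\<^bsub>G\<^esub> g)) x = (?I (rep (d s)) \<circ> rep (d g)) x"
      if d: "d \<in> hom G (Aut M)" for d
    proof -
      have 1: "AE x in M. rep (d (inv\<^bsub>G\<^esub> s \<otimes>\<^bsub>G\<^esub> g)) x = rep (d (inv\<^bsub>G\<^esub> s)) (rep (d g) x)"
        using rep_mult[OF hom_in_carrier[OF d invs] hom_in_carrier[OF d inv_gen(2)]]
          hom_mult[OF d invs inv_gen(2)] by simp
      have "d (inv\<^bsub>G\<^esub> s) = inv\<^bsub>Aut M\<^esub> (d s)"
        using group_hom.hom_inv[of G "Aut M" d s] G group_Aut d s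
        by (auto simp: group_hom_def group_hom_axioms_def)
      then have 2: "AE x in M. rep (d (inv\<^bsub>G\<^esub> s)) x = ?I (rep (d s)) x"
        using rep_inv[OF hom_in_carrier[OF d s]] by simp
      show ?thesis
        using 1 mp_AE_pullback[OF mp[OF d inv_gen(2)] 2] by eventually_elim simp
    qed
    have sg: "inv\<^bsub>G\<^esub> s \<otimes>\<^bsub>G\<^esub> g \<in> carrier G"
      using G invs inv_gen(2) by (simp add: group.is_monoid monoid.m_closed)
    have "image_dist M B (rep (c (inv\<^bsub>G\<^esub> s \<otimes>\<^bsub>G\<^esub> g))) (rep (b (inv\<^bsub>G\<^esub> s \<otimes>\<^bsub>G\<^esub> g))) =
      image_dist M B (?I (rep (c s)) \<circ> rep (c g)) (?I (rep (b s)) \<circ> rep (b g))"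
      by (rule image_dist_cong_AE) (intro mp mp_comp mp_inv prod b c s sg inv_gen)+
    also have "\<dots> \<le> image_dist M B (rep (c g)) (rep (b g)) +
        image_dist M (rep (b g) ` B) (?I (rep (c s))) (?I (rep (b s)))"
      by (intro image_dist_comp_le mp mp_inv b c s inv_gen)
    also have "image_dist M (rep (b g) ` B) (?I (rep (c s))) (?I (rep (b s))) =
        image_dist M B' (rep (c s)) (rep (b s))"
      unfolding B'_def by (intro image_dist_inv mp mp_image_sets b c s inv_gen)
    also have "image_dist M B (rep (c g)) (rep (b g)) + image_dist M B' (rep (c s)) (rep (b s)) < e"
      using near inv_gen(1) by fastforce
    finally show "image_dist M B (rep (c (inv\<^bsub>G\<^esub> s \<otimes>\<^bsub>G\<^esub> g))) (rep (b (inv\<^bsub>G\<^esub> s \<otimes>\<^bsub>G\<^esub> g))) < e" .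
  qed
qed

lemma holds_near_weak_open:
  assumes sb: "standard_borel_space M" and A: "dense_sequence M A"
    and G: "group G" and free: "free_generating_set G S" and b: "b \<in> hom G (Aut M)"
    and g: "g \<in> carrier G" and V: "openin (weak_topology M A) V" "b g \<in> V"
  shows "holds_near G M S b (\<lambda>c. c g \<in> V)"
proof -
  interpret Metric_space "carrier (Aut M)" "weak_dist M A" by (rule weak_dist_metric[OF sb A])
  obtain r where r: "r > 0" "mball (b g) r \<subseteq> V"
    using V unfolding weak_topology_def openin_mtopology by blast
  obtain K :: nat and \<delta> where K: "\<delta> > 0"
    "\<And>C D. (\<And>i. i < K \<Longrightarrow> image_dist M (A i) (rep C) (rep D) < \<delta>) \<Longrightarrow> weak_dist M A C D < r"
    by (rule weak_ball_contains_image_dist_ball[OF r(1), of A]) blast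
  have "A i \<in> sets M" for i using A by (auto simp: dense_sequence_def)
  then have "holds_near G M S b (\<lambda>c. \<forall>i\<in>{..<K}. image_dist M (A i) (rep (c g)) (rep (b g)) < \<delta>)"
    by (intro holds_near_finite_ball holds_near_image_dist[OF G free b g] K) auto
  then show ?thesis
  proof (rule holds_near_mono)
    fix c assume c: "c \<in> hom G (Aut M)" and "\<forall>i\<in>{..<K}. image_dist M (A i) (rep (c g)) (rep (b g)) < \<delta>"
    then have "weak_dist M A (c g) (b g) < r" using K(2) by simp
    then show "c g \<in> V"
      using r(2) hom_in_carrier[OF c g] hom_in_carrier[OF b g] commute by (auto simp: subset_iff)
  qed
qed

section \<open>Comparing orbits\<close>

lemma AE_rep_mult:
  assumes G: "group G" and cnt: "countable (carrier G)" and d: "d \<in> hom G (Aut M)"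
  shows "AE x in M. \<forall>k\<in>carrier G. \<forall>l\<in>carrier G. rep (d (k \<otimes>\<^bsub>G\<^esub> l)) x = rep (d k) (rep (d l) x)"
  using rep_mult[OF hom_in_carrier[OF d] hom_in_carrier[OF d]] hom_mult[OF d]
  by (simp add: AE_ball_countable[OF cnt])

lemma AE_rep_one_hom:
  assumes G: "group G" and d: "d \<in> hom G (Aut M)"
  shows "AE x in M. rep (d \<one>\<^bsub>G\<^esub>) x = x"
  using rep_one hom_one[OF d G group_Aut] by simp

text \<open>
  The multiplicativity of \<open>rep \<circ> d\<close> holds only almost everywhere, but there are countably many
  group elements, so almost every point satisfies all the relevant identities at once, and then
  the induction on \<open>n\<close> can be carried out at a single point.
\<close>

lemma AE_zpow_in_orbit:
  assumes G: "group G" and cnt: "countable (carrier G)" and d: "d \<in> hom G (Aut M)"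
    and s: "s \<in> carrier G" and R: "R \<in> mp_automorphisms M" "AE x in M. rep (d s) x = R x"
  shows "AE x in M. \<forall>n. zpow (space M) R n x \<in> orbit G d x"
proof -
  interpret G: group G by (rule G)
  have mp: "rep (d k) \<in> mp_automorphisms M" if "k \<in> carrier G" for k
    by (rule rep_mp[OF hom_in_carrier[OF d that]])
  have "AE x in M. \<forall>k\<in>carrier G. rep (d s) (rep (d k) x) = R (rep (d k) x)"
    using mp_AE_pullback[OF mp R(2)] by (simp add: AE_ball_countable[OF cnt])
  then show ?thesis
    using AE_rep_mult[OF G cnt d] AE_rep_one_hom[OF G d] AE_space
  proof eventually_elim
    case (elim x)
    have "\<exists>k\<in>carrier G. zpow (space M) R n x = rep (d k) x" for n
    proof (induction n rule: int_induct[where k = 0])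
      case base
      then show ?case using elim(3) by (intro bexI[of _ "\<one>\<^bsub>G\<^esub>"]) auto
    next
      case (step1 n)
      then obtain k where k: "k \<in> carrier G" "zpow (space M) R n x = rep (d k) x" by blast
      then have "zpow (space M) R (n + 1) x = rep (d (s \<otimes>\<^bsub>G\<^esub> k)) x"
        using zpow_step[OF R(1) elim(4)] elim(1,2) s by simp
      then show ?case using s k(1) by blast
    next
      case (step2 n)
      then obtain k where k: "k \<in> carrier G" "zpow (space M) R n x = rep (d k) x" by blast
      define l where "l = inv\<^bsub>G\<^esub> s \<otimes>\<^bsub>G\<^esub> k"
      have l: "l \<in> carrier G" "s \<otimes>\<^bsub>G\<^esub> l = k" using s k(1) by (simp_all add: l_def G.m_assoc[symmetric])
      have "R (rep (d l) x) = rep (d k) x" using elim(1,2) l s by metis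
      then have "zpow (space M) R (n - 1) x = rep (d l) x"
        using zpow_step_back[OF R(1) elim(4)] k(2) mp_inv_left[OF R(1) mp_in_space[OF mp[OF l(1)] elim(4)]]
        by simp
      then show ?case using l(1) by blast
    qed
    then show ?case by (auto simp: orbit_def)
  qed
qed

text \<open>
  The elements of \<open>G\<close> that move almost every point within its \<open>d\<close>-orbit form a subgroup, so it
  suffices to look at generators.
\<close>

lemma AE_orbit_subset:
  assumes G: "group G" and cnt: "countable (carrier G)" and free: "free_generating_set G S"
    and c: "c \<in> hom G (Aut M)" and d: "d \<in> hom G (Aut M)"
    and gen: "\<And>s. s \<in> S \<Longrightarrow> AE x in M. rep (c s) x \<in> orbit G d x"
  shows "AE x in M. orbit G c x \<subseteq> orbit G d x"
proof -
  interpret G: group G by (rule G)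
  have S: "S \<subseteq> carrier G" using free by (simp add: free_generating_set_def)
  have mp: "rep (e k) \<in> mp_automorphisms M" if "e \<in> hom G (Aut M)" "k \<in> carrier G" for e k
    by (rule rep_mp[OF hom_in_carrier[OF that]])
  have mult: "AE x in M. rep (c (g \<otimes>\<^bsub>G\<^esub> h)) x \<in> orbit G d x"
    if g: "g \<in> carrier G" "AE x in M. rep (c g) x \<in> orbit G d x"
      and h: "h \<in> carrier G" "AE x in M. rep (c h) x \<in> orbit G d x" for g h
  proof -
    show ?thesis
      using mp_AE_pullback[OF mp[OF c h(1)] g(2)] h(2) AE_rep_mult[OF G cnt d] AE_rep_mult[OF G cnt c]
    proof eventually_elim
      case (elim x)
      obtain l where l: "l \<in> carrier G" "rep (c h) x = rep (d l) x"
        using elim(2) by (auto simp: orbit_def)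
      obtain k where k: "k \<in> carrier G" "rep (c g) (rep (c h) x) = rep (d k) (rep (c h) x)"
        using elim(1) by (auto simp: orbit_def)
      have "rep (c (g \<otimes>\<^bsub>G\<^esub> h)) x = rep (d (k \<otimes>\<^bsub>G\<^esub> l)) x"
        using elim(3,4) k l g(1) h(1) by simp
      then show ?case using k(1) l(1) by (auto simp: orbit_def)
    qed
  qed
  have inv: "AE x in M. rep (c (inv\<^bsub>G\<^esub> s)) x \<in> orbit G d x" if s: "s \<in> S" for s
  proof -
    have sG: "s \<in> carrier G" using s S by blast
    have inv_mp: "rep (c (inv\<^bsub>G\<^esub> s)) \<in> mp_automorphisms M" using mp[OF c] sG by simp
    show ?thesis
      using mp_AE_pullback[OF inv_mp gen[OF s]] AE_rep_mult[OF G cnt c]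
        mp_AE_pullback[OF inv_mp AE_rep_mult[OF G cnt d]] AE_rep_one_hom[OF G c]
        mp_AE_pullback[OF inv_mp AE_rep_one_hom[OF G d]]
    proof eventually_elim
      case (elim x)
      define z where "z = rep (c (inv\<^bsub>G\<^esub> s)) x"
      have "rep (c s) z = x" using elim(2,4) sG unfolding z_def by (metis G.inv_closed G.r_inv)
      then obtain k where k: "k \<in> carrier G" "x = rep (d k) z"
        using elim(1) by (auto simp: orbit_def z_def)
      have "rep (d (inv\<^bsub>G\<^esub> k)) x = z"
        using elim(3,5) k unfolding z_def[symmetric] by (metis G.inv_closed G.l_inv)
      then show ?case using k(1) unfolding z_def by (metis G.inv_closed imageI orbit_def)
    qed
  qed
  have "AE x in M. rep (c g) x \<in> orbit G d x" if "g \<in> carrier G" for g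
    using free that
  proof (induction rule: G.free_generating_set_induct)
    case one
    have "c \<one>\<^bsub>G\<^esub> = d \<one>\<^bsub>G\<^esub>" using hom_one[OF c G group_Aut] hom_one[OF d G group_Aut] by simp
    then show ?case by (auto simp: orbit_def)
  next
    case (gen s g)
    then show ?case using mult[of s g] assms(6)[of s] S by blast
  next
    case (inv_gen s g)
    then show ?case using mult[of "inv\<^bsub>G\<^esub> s" g] inv[of s] S by (meson G.inv_closed subsetD)
  qed
  then have "AE x in M. \<forall>g\<in>carrier G. rep (c g) x \<in> orbit G d x"
    by (simp add: AE_ball_countable[OF cnt])
  then show ?thesis by eventually_elim (auto simp: orbit_def)
qed

lemma orbit_equivalentI_same_orbits:
  assumes G: "group G" and cnt: "countable (carrier G)" and a: "a \<in> hom G (Aut M)"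
    and same: "AE x in M. orbit G a x = orbit G c x"
  shows "orbit_equivalent G M a c"
proof -
  have mp: "rep (a g) \<in> mp_automorphisms M" if "g \<in> carrier G" for g
    by (rule rep_mp[OF hom_in_carrier[OF a that]])
  have "AE x in M. \<forall>g\<in>carrier G. rep \<one>\<^bsub>Aut M\<^esub> (rep (a g) x) = rep (a g) x"
    using mp_AE_pullback[OF mp rep_one] by (simp add: AE_ball_countable[OF cnt])
  then have "AE x in M. rep \<one>\<^bsub>Aut M\<^esub> ` orbit G a x = orbit G c (rep \<one>\<^bsub>Aut M\<^esub> x)"
    using same rep_one[of M]
  proof eventually_elim
    case (elim x)
    have "rep \<one>\<^bsub>Aut M\<^esub> ` orbit G a x = orbit G a x"
      unfolding orbit_def image_image by (rule image_cong[OF refl]) (use elim(1) in blast)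
    then show ?case unfolding elim(3) using elim(2) by metis
  qed
  moreover have "\<one>\<^bsub>Aut M\<^esub> \<in> carrier (Aut M)" by (simp add: aclass_id aclass_in mp_id)
  ultimately show ?thesis unfolding orbit_equivalent_def by blast
qed

section \<open>Density of the orbit equivalence class\<close>

text \<open>
  Replace every generator of \<open>a\<close> by a conjugate with the same orbits that is close to the
  generator of \<open>b\<close>, and extend to the free group. The orbits of an action are generated by those
  of its generators, hence the new action has the orbits of \<open>a\<close>.
\<close>

lemma orbit_equivalent_action_near:
  assumes na: "non_atomic M"
    and G: "group G" and cnt: "countable (carrier G)" and free: "free_generating_set G S"
    and a: "a \<in> hom G (Aut M)" and erg: "\<And>s. s \<in> S \<Longrightarrow> ergodic M (a s)"
    and b: "b \<in> hom G (Aut M)" and near: "holds_near G M S b P"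
  shows "\<exists>c\<in>hom G (Aut M). P c \<and> orbit_equivalent G M a c"
proof -
  have S: "S \<subseteq> carrier G" using free by (simp add: free_generating_set_def)
  obtain \<A> \<delta> where \<A>: "finite \<A>" "\<A> \<subseteq> sets M" "\<delta> > 0" and
    P: "\<And>c. c \<in> hom G (Aut M) \<Longrightarrow> (\<forall>s\<in>S. \<forall>A\<in>\<A>. image_dist M A (rep (c s)) (rep (b s)) < \<delta>) \<Longrightarrow> P c"
    using near unfolding holds_near_def by blast
  have mp: "rep (e s) \<in> mp_automorphisms M" if "e \<in> hom G (Aut M)" "s \<in> S" for e s
    using rep_mp[OF hom_in_carrier[OF that(1)]] that(2) S by blast
  have "\<exists>R\<in>mp_automorphisms M. (\<forall>A\<in>\<A>. image_dist M A R (rep (b s)) < \<delta>) \<and>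
      (\<forall>x\<in>space M. (\<exists>n. R x = zpow (space M) (rep (a s)) n x) \<and> (\<exists>n. rep (a s) x = zpow (space M) R n x))"
    if s: "s \<in> S" for s
  proof -
    interpret ergodic_automorphism M "rep (a s)"
      using mp[OF a s] erg[OF s] by unfold_locales (auto simp: ergodic_def)
    obtain W where W: "W \<in> mp_automorphisms M" "\<And>x. x \<in> space M \<Longrightarrow> \<exists>n. W x = \<tau> n x"
      "\<forall>A\<in>\<A>. prob (sym_diff ((inv_into (space M) W \<circ> rep (a s) \<circ> W) ` A) (rep (b s) ` A)) < \<delta>"
      using conjugate_approximation[OF na mp[OF b s] \<A>(3,1,2)] by blast
    show ?thesis
      using W conjugate_orbits[OF T W(1) W(2)] mp_comp[OF mp_comp[OF mp_inv[OF W(1)] T] W(1)]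
      by (intro bexI[of _ "inv_into (space M) W \<circ> rep (a s) \<circ> W"]) (auto simp: image_dist_def)
  qed
  then obtain R where R: "\<And>s. s \<in> S \<Longrightarrow> R s \<in> mp_automorphisms M"
    "\<And>s A. s \<in> S \<Longrightarrow> A \<in> \<A> \<Longrightarrow> image_dist M A (R s) (rep (b s)) < \<delta>"
    "\<And>s x. s \<in> S \<Longrightarrow> x \<in> space M \<Longrightarrow> \<exists>n. R s x = zpow (space M) (rep (a s)) n x"
    "\<And>s x. s \<in> S \<Longrightarrow> x \<in> space M \<Longrightarrow> \<exists>n. rep (a s) x = zpow (space M) (R s) n x"
    by metis
  have "(\<lambda>s. aclass M (R s)) ` S \<subseteq> carrier (Aut M)" using R(1) aclass_in by blast
  then obtain c where c: "c \<in> hom G (Aut M)" and c_gen: "\<And>s. s \<in> S \<Longrightarrow> c s = aclass M (R s)"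
    using free_extension[OF G group_Aut free] by blast
  have rep_c: "AE x in M. rep (c s) x = R s x" if "s \<in> S" for s
    using rep_aclass[OF R(1)] c_gen that by simp
  have "P c"
  proof (rule P[OF c], intro ballI)
    fix s A assume s: "s \<in> S" and A: "A \<in> \<A>"
    have "image_dist M A (rep (c s)) (rep (b s)) = image_dist M A (R s) (rep (b s))"
      by (rule image_dist_cong_AE) (use mp b c s R(1) A \<A>(2) rep_c[OF s] in auto)
    then show "image_dist M A (rep (c s)) (rep (b s)) < \<delta>" using R(2)[OF s A] by simp
  qed
  moreover have "AE x in M. orbit G a x = orbit G c x"
  proof -
    have "AE x in M. orbit G c x \<subseteq> orbit G a x"
    proof (rule AE_orbit_subset[OF G cnt free c a])
      fix s assume s: "s \<in> S"
      have "AE x in M. \<forall>n. zpow (space M) (rep (a s)) n x \<in> orbit G a x"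
        using AE_zpow_in_orbit[OF G cnt a _ mp[OF a s]] s S by auto
      then show "AE x in M. rep (c s) x \<in> orbit G a x"
        using rep_c[OF s] AE_space by eventually_elim (use R(3)[OF s] in metis)
    qed
    moreover have "AE x in M. orbit G a x \<subseteq> orbit G c x"
    proof (rule AE_orbit_subset[OF G cnt free a c])
      fix s assume s: "s \<in> S"
      have "AE x in M. \<forall>n. zpow (space M) (R s) n x \<in> orbit G c x"
        using AE_zpow_in_orbit[OF G cnt c _ R(1)[OF s] rep_c[OF s]] s S by auto
      then show "AE x in M. rep (a s) x \<in> orbit G c x"
        using AE_space by eventually_elim (use R(4)[OF s] in metis)
    qed
    ultimately show ?thesis by eventually_elim auto
  qed
  then have "orbit_equivalent G M a c" by (rule orbit_equivalentI_same_orbits[OF G cnt a])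
  ultimately show ?thesis using c by blast
qed

text \<open>
  A homomorphism is determined by its values on \<open>carrier G\<close>, while elements of \<open>actions G M\<close> are
  moreover \<open>undefined\<close> elsewhere.
\<close>

lemma restrict_action:
  assumes G: "group G" and c: "c \<in> hom G (Aut M)"
  shows "restrict c (carrier G) \<in> actions G M"
    and "orbit_equivalent G M a c \<Longrightarrow> orbit_equivalent G M a (restrict c (carrier G))"
proof -
  show "restrict c (carrier G) \<in> actions G M"
    using c group.is_monoid[OF G] by (auto simp: actions_def hom_def monoid.m_closed)
  have "orbit G (restrict c (carrier G)) x = orbit G c x" for x by (simp add: orbit_def)
  then show "orbit_equivalent G M a (restrict c (carrier G))" if "orbit_equivalent G M a c"
    using that by (simp add: orbit_equivalent_def)
qed

end

theorem theorem1p4: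
  fixes M :: "'x measure"
    and A :: "nat \<Rightarrow> 'x set"
    and G :: "('g, 'b) monoid_scheme"
    and S :: "'g set"
    and a :: "'g \<Rightarrow> ('x \<Rightarrow> 'x) set"
  assumes "prob_space M" and "standard_borel_space M" and "non_atomic M"
    and "dense_sequence M A"
    and "group G" and "finitely_generated G" and "\<not> comm_group G"
    and "free_generating_set G S"
    and "a \<in> actions G M" and "essentially_free G M a"
    and "\<And>s. s \<in> S \<Longrightarrow> ergodic M (a s)"
  shows "action_topology G M A closure_of oe_class G M a = actions G M"
proof
  interpret prob_space M by fact
  interpret Metric_space "carrier (Aut M)" "weak_dist M A"
    by (rule weak_dist_metric[OF assms(2,4)])
  have top_weak: "topspace (weak_topology M A) = carrier (Aut M)" by (simp add: weak_topology_def)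
  have "actions G M \<subseteq> (\<Pi>\<^sub>E g\<in>carrier G. carrier (Aut M))"
    by (auto simp: actions_def hom_def PiE_def)
  then have top: "topspace (action_topology G M A) = actions G M"
    by (simp add: action_topology_def top_weak Int_absorb1)
  then show "action_topology G M A closure_of oe_class G M a \<subseteq> actions G M"
    using closure_of_subset_topspace by metis
  have a: "a \<in> hom G (Aut M)" using assms(9) by (simp add: actions_def)
  have cnt: "countable (carrier G)" by (rule group.finitely_generated_countable[OF assms(5,6)])
  show "actions G M \<subseteq> action_topology G M A closure_of oe_class G M a"
  proof
    fix b assume bA: "b \<in> actions G M"
    then have b: "b \<in> hom G (Aut M)" by (simp add: actions_def)
    have "\<exists>c. c \<in> oe_class G M a \<and> c \<in> U" if U: "b \<in> U" "openin (action_topology G M A) U" for U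
    proof -
      obtain U' where U': "openin (product_topology (\<lambda>_. weak_topology M A) (carrier G)) U'" "U = U' \<inter> actions G M"
        using U(2) by (auto simp: action_topology_def openin_subtopology)
      then obtain V where V: "finite {g \<in> carrier G. V g \<noteq> carrier (Aut M)}"
        "\<And>g. g \<in> carrier G \<Longrightarrow> openin (weak_topology M A) (V g)"
        "b \<in> Pi\<^sub>E (carrier G) V" "Pi\<^sub>E (carrier G) V \<subseteq> U'"
        using U(1) unfolding openin_product_topology_alt top_weak by auto
      define J where "J = {g \<in> carrier G. V g \<noteq> carrier (Aut M)}"
      have "holds_near G M S b (\<lambda>c. \<forall>g\<in>J. c g \<in> V g)"
        using V by (intro holds_near_finite_ball holds_near_weak_open[OF assms(2,4,5,8) b])
          (auto simp: J_def)
      then obtain c where c: "c \<in> hom G (Aut M)" "\<forall>g\<in>J. c g \<in> V g" "orbit_equivalent G M a c"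
        using orbit_equivalent_action_near[OF assms(3,5) cnt assms(8) a assms(11) b] by blast
      define c' where "c' = restrict c (carrier G)"
      have c': "c' \<in> actions G M" "orbit_equivalent G M a c'"
        unfolding c'_def using restrict_action[OF assms(5) c(1)] c(3) by auto
      have "c g \<in> V g" if "g \<in> carrier G" for g
        using c(2) hom_in_carrier[OF c(1) that] that by (cases "g \<in> J") (auto simp: J_def)
      then have "c' \<in> Pi\<^sub>E (carrier G) V" by (auto simp: c'_def)
      then show ?thesis using c' V(4) U'(2) by (auto simp: oe_class_def)
    qed
    then show "b \<in> action_topology G M A closure_of oe_class G M a"
      using bA top by (auto simp: in_closure_of)
  qed
qed

end
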